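(* Let $A$ be a (possibly unbounded) scalar type spectral operator in a complex Banach space with spectral measure $E_A(\cdot)$. (1) If $F:\sigma(A)\to\mathbb{C}$ is a Borel measurable function, then $$\sigma_p(F(A))\supseteq F(\sigma_p(A)).$$ (2) If $F:\sigma(A)\to\mathbb{C}$ is a Borel measurable function which is also injective, then $$\sigma_p(F(A))=F(\sigma_p(A)),$$ with $$E_{F(A)}(\{F(\lambda)\})=E_A(\{\lambda\})\quad\text{and hence}\quad \ker(F(A)-F(\lambda)I)=\ker(A-\lambda I),\qquad \lambda\in\sigma_p(A),$$ and $$\rho(F(A))\cup\sigma_c(F(A))\supseteq F(\sigma_c(A)).$$ In particular, if $\sigma_p(A)=\emptyset$, then $\sigma_p(F(A))=\emptyset$. (3) If $F:\sigma(A)\to\mathbb{C}$ is a continuous and injective function, then $$\sigma_c(F(A))=F(\sigma_c(A))\cup\left(\overline{F(\sigma(A))}\setminus F(\sigma(A))\right).$$ In particular, if in addition the set $F(\sigma(A))$ is closed (as is the case when the operator $A$ is bounded, and hence so is $F(A)$), then $$\sigma_c(F(A))=F(\sigma_c(A)).$$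
   Context: Spectrum: for a closed linear operator $B$ in a complex Banach space $X$, the resolvent set $\rho(B)$ is the set of $\lambda\in\mathbb{C}$ for which $(B-\lambda I)^{-1}$ exists as a bounded linear operator on all of $X$, and $\sigma(B)=\mathbb{C}\setminus\rho(B)$. The point spectrum $\sigma_p(B)$ is the set of $\lambda\in\mathbb{C}$ with $B-\lambda I$ not injective; the continuous spectrum $\sigma_c(B)$ is the set of $\lambda\in\mathbb{C}$ with $B-\lambda I$ injective, not surjective, and with range dense in $X$. Scalar type spectral operator (Dunford, Bade): a densely defined closed linear operator $A$ in $X$ for which there is a (necessarily unique) strongly $\sigma$-additive spectral measure $E_A$ (the resolution of the identity), i.e. a map from the Borel sets of $\mathbb{C}$ to bounded projections on $X$ with $E_A(\emptyset)=0$, $E_A(\mathbb{C})=I$, $E_A(\delta_1\cap\delta_2)=E_A(\delta_1)E_A(\delta_2)$, and $\sigma$-additive in the strong operator topology, such that $A=\int_{\mathbb{C}}\lambda\,dE_A(\lambda)$. The spectrum $\sigma(A)$ is the support of $E_A$: $\sigma(A)$ is closed, $E_A(\mathbb{C}\setminus\sigma(A))=0$, and $E_A(U)\ne0$ for every open $U\subseteq\mathbb{C}$ meeting $\sigma(A)$. Borel operational calculus: for a bounded Borel function $G$ on $\sigma(A)$, $\int_{\sigma(A)} G\,dE_A$ is the operator-norm limit of the integrals of simple Borel functions converging uniformly to $G$. For a Borel measurable $F:\sigma(A)\to\mathbb{C}$, put $e_n=\{\lambda\in\sigma(A):|F(\lambda)|\le n\}$; then $F(A)=\int_{\sigma(A)}F(\lambda)\,dE_A(\lambda)$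 is the operator with domain consisting of all $f\in X$ for which $\lim_{n\to\infty}\left(\int_{\sigma(A)} F\chi_{e_n}\,dE_A\right)f$ exists, $F(A)f$ being this limit. The integral $A=\int\lambda\,dE_A(\lambda)$ is understood in the same way (with $F(\lambda)=\lambda$). $F(A)$ is again a scalar type spectral operator, and its spectral measure $E_{F(A)}$ is given by $E_{F(A)}(\delta)=E_A(F^{-1}(\delta))$ for Borel $\delta\subseteq\mathbb{C}$. The bar denotes closure in $\mathbb{C}$. *)

theory Defs
  imports "HOL-Analysis.Analysis"
begin

class complex_banach = banach +
  fixes scaleC :: "complex \<Rightarrow> 'a \<Rightarrow> 'a"  (infixr "*\<^sub>C" 75)
  assumes scaleC_add_right: "c *\<^sub>C (x + y) = c *\<^sub>C x + c *\<^sub>C y"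
    and scaleC_add_left: "(b + c) *\<^sub>C x = b *\<^sub>C x + c *\<^sub>C x"
    and scaleC_scaleC: "b *\<^sub>C (c *\<^sub>C x) = (b * c) *\<^sub>C x"
    and scaleC_of_real: "of_real r *\<^sub>C x = r *\<^sub>R x"
    and norm_scaleC: "norm (c *\<^sub>C x) = cmod c * norm x"

lemma bounded_linear_scaleC: "bounded_linear (scaleC c :: 'a \<Rightarrow> 'a::complex_banach)"
proof (rule bounded_linear_intro[where K = "cmod c"])
  fix r :: real and x :: 'a
  show "c *\<^sub>C (r *\<^sub>R x) = r *\<^sub>R (c *\<^sub>C x)"
    by (metis scaleC_of_real scaleC_scaleC mult.commute)
qed (auto simp: scaleC_add_right norm_scaleC mult.commute)

text \<open>
  The library type \<open>'a \<Rightarrow>\<^sub>L 'b\<close> consists of the bounded real-linear maps with the operator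
  norm. It becomes a complex Banach space under pointwise complex scaling; the complex-linear
  maps among them are singled out by \<open>complex_linear\<close> below.
\<close>

instantiation blinfun :: (real_normed_vector, complex_banach) complex_banach
begin

lift_definition scaleC_blinfun :: "complex \<Rightarrow> 'a \<Rightarrow>\<^sub>L 'b \<Rightarrow> 'a \<Rightarrow>\<^sub>L 'b" is "\<lambda>c T x. c *\<^sub>C T x"
  by (rule bounded_linear_compose[OF bounded_linear_scaleC])

instance
proof
  fix b c :: complex and r :: real and S T :: "'a \<Rightarrow>\<^sub>L 'b"
  show "c *\<^sub>C (S + T) = c *\<^sub>C S + c *\<^sub>C T"
    by transfer (simp add: scaleC_add_right)
  show "(b + c) *\<^sub>C T = b *\<^sub>C T + c *\<^sub>C T"
    by transfer (simp add: scaleC_add_left)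
  show "b *\<^sub>C (c *\<^sub>C T) = (b * c) *\<^sub>C T"
    by transfer (simp add: scaleC_scaleC)
  show "of_real r *\<^sub>C T = r *\<^sub>R T"
    by transfer (simp add: scaleC_of_real)
  have le: "norm (d *\<^sub>C U) \<le> cmod d * norm U" for d :: complex and U :: "'a \<Rightarrow>\<^sub>L 'b"
  proof (rule norm_blinfun_bound)
    fix x
    show "norm ((d *\<^sub>C U) x) \<le> cmod d * norm U * norm x"
      by (simp add: scaleC_blinfun.rep_eq norm_scaleC mult.assoc mult_left_mono norm_blinfun)
  qed simp
  show "norm (c *\<^sub>C T) = cmod c * norm T"
  proof (cases "c = 0")
    case True
    then show ?thesis using le[of 0 T] by simp
  next
    case False
    have "inverse c *\<^sub>C c *\<^sub>C T = T"
      using False scaleC_of_real[of 1]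
      by (intro blinfun_eqI) (simp add: scaleC_blinfun.rep_eq scaleC_scaleC)
    then have "norm T \<le> norm (c *\<^sub>C T) / cmod c"
      using le[of "inverse c" "c *\<^sub>C T"] by (simp add: norm_inverse divide_inverse mult.commute)
    then show ?thesis
      using False le[of c T] by (simp add: field_simps)
  qed
qed

end

definition complex_linear :: "('a::complex_banach \<Rightarrow>\<^sub>L 'a) \<Rightarrow> bool" where
  "complex_linear T \<longleftrightarrow> (\<forall>c x. T (c *\<^sub>C x) = c *\<^sub>C T x)"


section \<open>Unbounded operators and their spectra\<close>

text \<open>
  An operator in \<open>X\<close> is a partial map \<open>B :: 'a \<rightharpoonup> 'a\<close>: its domain is \<open>dom B\<close>, its range \<open>ran B\<close>
  and its graph \<open>Map.graph B\<close>. Equality of partial maps is equality of operators, domains included.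
\<close>

definition linear_operator :: "('a::complex_banach \<rightharpoonup> 'a) \<Rightarrow> bool" where
  "linear_operator B \<longleftrightarrow>
     B 0 = Some 0 \<and>
     (\<forall>f g u v. B f = Some u \<longrightarrow> B g = Some v \<longrightarrow> B (f + g) = Some (u + v)) \<and>
     (\<forall>c f u. B f = Some u \<longrightarrow> B (c *\<^sub>C f) = Some (c *\<^sub>C u))"

definition closed_operator :: "('a::complex_banach \<rightharpoonup> 'a) \<Rightarrow> bool" where
  "closed_operator B \<longleftrightarrow> closed (Map.graph B)"

definition densely_defined :: "('a::complex_banach \<rightharpoonup> 'a) \<Rightarrow> bool" where
  "densely_defined B \<longleftrightarrow> closure (dom B) = UNIV"

definition bounded_operator :: "('a::complex_banach \<rightharpoonup> 'a) \<Rightarrow> bool" where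
  "bounded_operator B \<longleftrightarrow> (\<exists>T. complex_linear T \<and> (\<forall>f. B f = Some (blinfun_apply T f)))"

text \<open>The operator \<open>B - \<mu>I\<close>, with domain \<open>dom B\<close>.\<close>

definition shift :: "('a::complex_banach \<rightharpoonup> 'a) \<Rightarrow> complex \<Rightarrow> ('a \<rightharpoonup> 'a)" where
  "shift B \<mu> f = map_option (\<lambda>u. u - \<mu> *\<^sub>C f) (B f)"

definition kernel :: "('a::complex_banach \<rightharpoonup> 'a) \<Rightarrow> 'a set" where
  "kernel B = {f. B f = Some 0}"

definition resolvent_set :: "('a::complex_banach \<rightharpoonup> 'a) \<Rightarrow> complex set" where
  "resolvent_set B =
     {\<mu>. \<exists>R. complex_linear R \<and> (\<forall>f g. shift B \<mu> f = Some g \<longleftrightarrow> blinfun_apply R g = f)}"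

definition spectrum :: "('a::complex_banach \<rightharpoonup> 'a) \<Rightarrow> complex set" where
  "spectrum B = - resolvent_set B"

definition point_spectrum :: "('a::complex_banach \<rightharpoonup> 'a) \<Rightarrow> complex set" where
  "point_spectrum B = {\<mu>. \<not> inj_on (shift B \<mu>) (dom B)}"

definition continuous_spectrum :: "('a::complex_banach \<rightharpoonup> 'a) \<Rightarrow> complex set" where
  "continuous_spectrum B =
     {\<mu>. inj_on (shift B \<mu>) (dom B) \<and> ran (shift B \<mu>) \<noteq> UNIV \<and> closure (ran (shift B \<mu>)) = UNIV}"


section \<open>Spectral measures and the Borel operational calculus\<close>

text \<open>Only the values of \<open>E\<close> on Borel sets are meaningful.\<close>

definition spectral_measure :: "(complex set \<Rightarrow> ('a::complex_banach \<Rightarrow>\<^sub>L 'a)) \<Rightarrow> bool" where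
  "spectral_measure E \<longleftrightarrow>
     (\<forall>\<delta>\<in>sets borel. complex_linear (E \<delta>) \<and> E \<delta> o\<^sub>L E \<delta> = E \<delta>) \<and>
     E {} = 0 \<and> E UNIV = id_blinfun \<and>
     (\<forall>\<delta>\<^sub>1\<in>sets borel. \<forall>\<delta>\<^sub>2\<in>sets borel. E (\<delta>\<^sub>1 \<inter> \<delta>\<^sub>2) = E \<delta>\<^sub>1 o\<^sub>L E \<delta>\<^sub>2) \<and>
     (\<forall>\<delta> :: nat \<Rightarrow> complex set. range \<delta> \<subseteq> sets borel \<longrightarrow> disjoint_family \<delta> \<longrightarrow>
        (\<forall>f. (\<lambda>n. blinfun_apply (E (\<delta> n)) f) sums blinfun_apply (E (\<Union>n. \<delta> n)) f))"

text \<open>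
  In the integrals below, \<open>S\<close> is the Borel set over which one integrates; values of the integrand
  outside \<open>S\<close> are irrelevant.
\<close>

definition simple_spectral_integral ::
    "(complex set \<Rightarrow> ('a::complex_banach \<Rightarrow>\<^sub>L 'a)) \<Rightarrow> complex set \<Rightarrow> (complex \<Rightarrow> complex) \<Rightarrow> ('a \<Rightarrow>\<^sub>L 'a)"
  where
  "simple_spectral_integral E S s = (\<Sum>c\<in>s ` S. c *\<^sub>C E {z \<in> S. s z = c})"

definition bounded_spectral_integral ::
    "(complex set \<Rightarrow> ('a::complex_banach \<Rightarrow>\<^sub>L 'a)) \<Rightarrow> complex set \<Rightarrow> (complex \<Rightarrow> complex) \<Rightarrow> ('a \<Rightarrow>\<^sub>L 'a)"
  where
  "bounded_spectral_integral E S G =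
     (THE T. \<exists>s :: nat \<Rightarrow> complex \<Rightarrow> complex.
        (\<forall>n. simple_function (restrict_space borel S) (s n)) \<and>
        uniform_limit S s G sequentially \<and>
        (\<lambda>n. simple_spectral_integral E S (s n)) \<longlonglongrightarrow> T)"

definition truncation :: "complex set \<Rightarrow> (complex \<Rightarrow> complex) \<Rightarrow> nat \<Rightarrow> complex \<Rightarrow> complex" where
  "truncation S F n z = F z * indicator {\<mu> \<in> S. cmod (F \<mu>) \<le> real n} z"

definition spectral_integral ::
    "(complex set \<Rightarrow> ('a::complex_banach \<Rightarrow>\<^sub>L 'a)) \<Rightarrow> complex set \<Rightarrow> (complex \<Rightarrow> complex) \<Rightarrow> ('a \<rightharpoonup> 'a)"
  where
  "spectral_integral E S F f =
     (let I = (\<lambda>n. blinfun_apply (bounded_spectral_integral E S (truncation S F n)) f)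
      in if convergent I then Some (lim I) else None)"

definition resolution_of_identity ::
    "('a::complex_banach \<rightharpoonup> 'a) \<Rightarrow> (complex set \<Rightarrow> ('a \<Rightarrow>\<^sub>L 'a)) \<Rightarrow> bool" where
  "resolution_of_identity A E \<longleftrightarrow> spectral_measure E \<and> A = spectral_integral E UNIV (\<lambda>z. z)"

definition scalar_type_spectral_operator :: "('a::complex_banach \<rightharpoonup> 'a) \<Rightarrow> bool" where
  "scalar_type_spectral_operator A \<longleftrightarrow>
     linear_operator A \<and> closed_operator A \<and> densely_defined A \<and>
     (\<exists>E. resolution_of_identity A E)"

text \<open>The operator \<open>F(A)\<close>, where \<open>E\<close> is the resolution of the identity of \<open>A\<close>.\<close>

definition borel_calculus ::
    "('a::complex_banach \<rightharpoonup> 'a) \<Rightarrow> (complex set \<Rightarrow> ('a \<Rightarrow>\<^sub>L 'a)) \<Rightarrow> (complex \<Rightarrow> complex) \<Rightarrow> ('a \<rightharpoonup> 'a)"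
  where
  "borel_calculus A E F = spectral_integral E (spectrum A) F"

end

theory Submission
  imports Defs
begin

text \<open>
  Everything is read off the resolution of the identity. For the operator \<open>A = \<integral> z dE(z)\<close> one has
  \<open>ker (A - \<mu>I) = ran E({\<mu>})\<close>, the closure of \<open>ran (A - \<mu>I)\<close> is \<open>ker E({\<mu>})\<close>, and \<open>\<mu>\<close> is in the resolvent
  set iff \<open>E\<close> vanishes on some disc about \<open>\<mu>\<close>. Hence \<open>\<mu>\<close> is an eigenvalue iff \<open>E({\<mu>}) \<noteq> 0\<close>, belongs to
  the continuous spectrum iff \<open>E({\<mu>}) = 0\<close> but no disc about \<open>\<mu>\<close> is null, and there is no residual
  spectrum. By change of variables \<open>F(A)\<close> is the operator of the same kind for the image measure
  \<open>\<delta> \<mapsto> E(F\<^sup>-\<^sup>1(\<delta>))\<close>, so all claims become statements about preimages of points and discs.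
\<close>

text \<open>Countable additivity is assumed only strongly, and no uniform bound on the projections
  is part of the definition. Such a bound is needed before \<open>bounded_spectral_integral\<close>,
  a definite description, can be shown to denote anything; this is why uniform boundedness comes
  first. If M bounds the projections, the integral of a function bounded by b has norm at most 4 M
  b, and this estimate carries the analysis that follows. The second obstacle is that operators are
  partial maps, so that every identity is also one of domains. Computations are therefore done with
  bounded functions g for which z g(z) is bounded too, and the unbounded statements are recovered by
  letting discs grow to the plane or shrink to \<mu>. Finally, \<open>E\<^sub>F\<close> in the claim
  is an arbitrary resolution of the identity of F(A), not a priori the image measure; the two need
  to be compared at single points only. For F merely Borel nothing keeps discs about F(\<mu>) from
  being null, whence the resolvent set in (2); in (3) continuity excludes this.\<close>

section \<open>Uniform boundedness\<close>

text \<open>By Baire, one of the closed sets \<open>C n\<close>, which cover the space, contains a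
  ball. Differences of points of that ball reach every direction, which turns the pointwise bound n
  into a bound on the operator norm.\<close>

lemma uniform_boundedness:
  fixes \<F> :: "('a::banach \<Rightarrow>\<^sub>L 'b::real_normed_vector) set"
  assumes "\<And>x. \<exists>M. \<forall>T\<in>\<F>. norm (blinfun_apply T x) \<le> M"
  shows "\<exists>M\<ge>0. \<forall>T\<in>\<F>. norm T \<le> M"
proof -
  define C where "C n = {x. \<forall>T\<in>\<F>. norm (blinfun_apply T x) \<le> real n}" for n :: nat
  have closed_C: "closed (C n)" for n
  proof -
    have "C n = (\<Inter>T\<in>\<F>. {x. norm (blinfun_apply T x) \<le> real n})"
      by (auto simp: C_def)
    moreover have "closed {x. norm (blinfun_apply T x) \<le> real n}" for T :: "'a \<Rightarrow>\<^sub>L 'b"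
      by (intro closed_Collect_le continuous_intros)
    ultimately show ?thesis by auto
  qed
  have "(\<Union>n. C n) = UNIV"
  proof (intro equalityI subset_UNIV subsetI)
    fix x :: 'a
    obtain M where "\<forall>T\<in>\<F>. norm (blinfun_apply T x) \<le> M" using assms by blast
    moreover obtain n where "M \<le> real n" using real_arch_simple by blast
    ultimately have "x \<in> C n" by (force simp: C_def)
    then show "x \<in> (\<Union>n. C n)" by blast
  qed
  moreover have "interior (\<Union>(range C)) = {}" if "\<And>n. interior (C n) = {}"
    using Baire_category_alt[of "euclidean :: 'a topology" "range C"] closed_C that
      completely_metrizable_space_euclidean
    by (auto simp: euclidean_interior_of)
  ultimately obtain n where "interior (C n) \<noteq> {}" by auto
  then obtain x e where e: "e > 0" "cball x e \<subseteq> C n"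
    by (metis all_not_in_conv mem_interior_cball)
  show ?thesis
  proof (intro exI conjI ballI)
    show "0 \<le> 2 * real n / e" using e by simp
    fix T assume T: "T \<in> \<F>"
    show "norm T \<le> 2 * real n / e"
    proof (rule norm_blinfun_bound)
      fix y :: 'a
      show "norm (blinfun_apply T y) \<le> 2 * real n / e * norm y"
      proof (cases "y = 0")
        case False
        \<comment> \<open>Rescaled to norm e, so that \<open>x + w\<close> and x both lie in the
          ball; then T w is a difference of two vectors of norm at most n.\<close>
        define w where "w = (e / norm y) *\<^sub>R y"
        have "x + w \<in> C n" "x \<in> C n"
          using e False by (auto simp: w_def dist_norm subset_iff)
        then have "norm (blinfun_apply T (x + w)) \<le> n" "norm (blinfun_apply T x) \<le> n"
          using T by (auto simp: C_def)
        then have "norm (blinfun_apply T w) \<le> 2 * n"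
          using norm_triangle_ineq4[of "blinfun_apply T (x + w)" "blinfun_apply T x"]
          by (simp add: blinfun.add_right)
        then show ?thesis
          using e False by (simp add: w_def blinfun.scaleR_right field_simps)
      qed simp
    qed (use e in simp)
  qed
qed

lemma uniform_boundedness_convergent:
  fixes T :: "nat \<Rightarrow> 'a::banach \<Rightarrow>\<^sub>L 'b::real_normed_vector"
  assumes "\<And>x. convergent (\<lambda>n. blinfun_apply (T n) x)"
  shows "\<exists>M\<ge>0. \<forall>n. norm (T n) \<le> M"
proof -
  have "\<exists>M. \<forall>U\<in>range T. norm (blinfun_apply U x) \<le> M" for x
    using convergent_imp_Bseq[OF assms] by (auto simp: Bseq_def)
  from uniform_boundedness[OF this] show ?thesis by auto
qed

text \<open>If \<open>\<mu>\<close> is unbounded on the subsets of \<open>A\<close>, then some \<open>D \<subseteq> A\<close> carries a large value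
  while \<open>\<mu>\<close> stays unbounded on the subsets of \<open>A - D\<close>; iterating produces a disjoint sequence.\<close>

lemma exhaustive_imp_bounded:
  fixes \<mu> :: "'b set \<Rightarrow> 'a::real_normed_vector"
  assumes "sigma_algebra \<Omega> M"
    and add: "\<And>A B. A \<in> M \<Longrightarrow> B \<in> M \<Longrightarrow> A \<inter> B = {} \<Longrightarrow> \<mu> (A \<union> B) = \<mu> A + \<mu> B"
    and exh: "\<And>D :: nat \<Rightarrow> 'b set. range D \<subseteq> M \<Longrightarrow> disjoint_family D \<Longrightarrow> (\<lambda>n. \<mu> (D n)) \<longlonglongrightarrow> 0"
  shows "\<exists>K. \<forall>A\<in>M. norm (\<mu> A) \<le> K"
proof (rule ccontr)
  interpret sigma_algebra \<Omega> M by fact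
  define unb where "unb A \<longleftrightarrow> (\<forall>K. \<exists>B\<in>M. B \<subseteq> A \<and> norm (\<mu> B) > K)" for A
  assume "\<not> ?thesis"
  then have "unb \<Omega>" unfolding unb_def by (meson not_le sets_into_space)
  have diff: "\<mu> (A - B) = \<mu> A - \<mu> B" if "A \<in> M" "B \<in> M" "B \<subseteq> A" for A B
    using add[of B "A - B"] that by (simp add: Diff Un_absorb1 algebra_simps)
  have split: "unb B \<or> unb (A - B)" if A: "A \<in> M" "unb A" "B \<in> M" for A B
  proof (rule ccontr)
    assume "\<not> ?thesis"
    then obtain K1 K2 where
      K1: "\<And>C. C \<in> M \<Longrightarrow> C \<subseteq> B \<Longrightarrow> norm (\<mu> C) \<le> K1" and
      K2: "\<And>C. C \<in> M \<Longrightarrow> C \<subseteq> A - B \<Longrightarrow> norm (\<mu> C) \<le> K2"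
      unfolding unb_def by (meson not_less)
    obtain C where C: "C \<in> M" "C \<subseteq> A" "norm (\<mu> C) > K1 + K2"
      using A unfolding unb_def by blast
    have "\<mu> C = \<mu> (C \<inter> B) + \<mu> (C - B)"
      using add[of "C \<inter> B" "C - B"] C(1) A(3) by (simp add: Int_Diff_Un Int Diff Diff_Int_distrib Int_Diff)
    moreover have "norm (\<mu> (C \<inter> B)) \<le> K1" "norm (\<mu> (C - B)) \<le> K2"
      using C A by (auto intro!: K1 K2)
    ultimately show False
      using C(3) norm_triangle_ineq[of "\<mu> (C \<inter> B)" "\<mu> (C - B)"] by simp
  qed
  \<comment> \<open>Choosing the value at B larger than the value at A by n makes both B and A - B
    large. Hence whichever of the two stays unbounded may be kept, and the piece removed is large in
    either case.\<close>
  have step: "\<exists>A'. (A' \<in> M \<and> unb A') \<and> A' \<subseteq> A \<and> real n \<le> norm (\<mu> (A - A'))"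
    if A: "A \<in> M \<and> unb A" for A n
  proof -
    obtain B where B: "B \<in> M" "B \<subseteq> A" "norm (\<mu> B) > norm (\<mu> A) + n"
      using A unfolding unb_def by blast
    have "norm (\<mu> (A - B)) \<ge> n"
      using B A diff[of A B] norm_triangle_ineq2[of "\<mu> B" "\<mu> A"] by (simp add: norm_minus_commute)
    moreover have "norm (\<mu> (A - (A - B))) \<ge> n"
      unfolding double_diff[OF B(2) subset_refl] using B(3) norm_ge_zero[of "\<mu> A"] by linarith
    moreover have "A - B \<in> M" using A B by auto
    ultimately show ?thesis using split[of A B] A B by blast
  qed
  have "\<exists>A. \<forall>n. (A n \<in> M \<and> unb (A n)) \<and> A (Suc n) \<subseteq> A n \<and> real n \<le> norm (\<mu> (A n - A (Suc n)))"
    by (rule dependent_nat_choice) (use \<open>unb \<Omega>\<close> step in auto)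
  then obtain A where A: "\<And>n. A n \<in> M" "\<And>n. A (Suc n) \<subseteq> A n"
      "\<And>n. real n \<le> norm (\<mu> (A n - A (Suc n)))"
    by blast
  have "decseq A" by (rule decseq_SucI) (rule A)
  have "disjoint_family (\<lambda>n. A n - A (Suc n))"
  proof -
    have "(A m - A (Suc m)) \<inter> (A n - A (Suc n)) = {}" if "m < n" for m n
      using decseqD[OF \<open>decseq A\<close>, of "Suc m" n] that by auto
    then show ?thesis
      unfolding disjoint_family_on_def by (metis Int_commute linorder_neqE_nat)
  qed
  with exh[of "\<lambda>n. A n - A (Suc n)"] A(1) have "(\<lambda>n. \<mu> (A n - A (Suc n))) \<longlonglongrightarrow> 0" by auto
  then have "Bseq (\<lambda>n. \<mu> (A n - A (Suc n)))" using convergentI convergent_imp_Bseq by blast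
  then obtain K where K: "\<And>n. norm (\<mu> (A n - A (Suc n))) \<le> K" by (auto simp: Bseq_def)
  obtain n where "K < real n" using reals_Archimedean2 by blast
  with A(3)[of n] K[of n] show False by linarith
qed

section \<open>Complex scaling and complex-linear maps\<close>

lemma scaleC_one [simp]: "1 *\<^sub>C x = (x :: 'a::complex_banach)"
  using scaleC_of_real[of 1 x] by simp

lemma scaleC_zero_left [simp]: "0 *\<^sub>C x = (0 :: 'a::complex_banach)"
  using scaleC_of_real[of 0 x] by simp

lemma bounded_bilinear_scaleC: "bounded_bilinear (scaleC :: complex \<Rightarrow> 'a \<Rightarrow> 'a::complex_banach)"
proof
  fix a b :: complex and x y :: 'a and r :: real
  show "(r *\<^sub>R a) *\<^sub>C x = r *\<^sub>R (a *\<^sub>C x)"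
    by (simp add: scaleR_conv_of_real flip: scaleC_scaleC scaleC_of_real)
  show "a *\<^sub>C (r *\<^sub>R x) = r *\<^sub>R (a *\<^sub>C x)"
    using bounded_linear_scaleC by (rule linear_simps)
  show "\<exists>K. \<forall>a (x::'a). norm (a *\<^sub>C x) \<le> norm a * norm x * K"
    by (rule exI[of _ 1]) (simp add: norm_scaleC)
qed (simp_all add: scaleC_add_left scaleC_add_right)

interpretation scaleC: bounded_bilinear "scaleC :: complex \<Rightarrow> 'a \<Rightarrow> 'a::complex_banach"
  by (rule bounded_bilinear_scaleC)

lemmas scaleC_blinfun_apply [simp] = scaleC_blinfun.rep_eq

lemma complex_linear_0: "complex_linear 0"
  and complex_linear_add: "complex_linear S \<Longrightarrow> complex_linear T \<Longrightarrow> complex_linear (S + T)"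
  and complex_linear_scaleC: "complex_linear T \<Longrightarrow> complex_linear (c *\<^sub>C T)"
  by (auto simp: complex_linear_def blinfun.bilinear_simps scaleC_add_right scaleC_scaleC mult.commute)

lemma complex_linear_sum: "(\<And>i. i \<in> I \<Longrightarrow> complex_linear (T i)) \<Longrightarrow> complex_linear (sum T I)"
  by (induction I rule: infinite_finite_induct) (auto intro: complex_linear_0 complex_linear_add)

lemma complex_linear_LIMSEQ:
  assumes "\<And>n. complex_linear (T n)" "T \<longlonglongrightarrow> U"
  shows "complex_linear U"
  unfolding complex_linear_def
proof (intro allI)
  fix c x
  have "(\<lambda>n. blinfun_apply (T n) (c *\<^sub>C x)) \<longlonglongrightarrow> U (c *\<^sub>C x)"
    by (intro tendsto_intros assms)
  moreover have "(\<lambda>n. blinfun_apply (T n) (c *\<^sub>C x)) \<longlonglongrightarrow> c *\<^sub>C U x"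
    using assms(1) unfolding complex_linear_def
    by (auto intro!: tendsto_intros scaleC.tendsto assms(2))
  ultimately show "U (c *\<^sub>C x) = c *\<^sub>C U x" by (rule LIMSEQ_unique)
qed

lemma scaleC_compose: "(b *\<^sub>C S) o\<^sub>L (c *\<^sub>C T) = (b * c) *\<^sub>C (S o\<^sub>L T)" if "complex_linear S"
  using that by (intro blinfun_eqI) (simp add: complex_linear_def scaleC_scaleC)

text \<open>The left-hand side is affine in each \<open>a i\<close>, so its norm is largest when all \<open>a i\<close> are
  \<open>0\<close> or \<open>1\<close>.\<close>

lemma norm_unit_interval_combination_le:
  fixes e :: "'i \<Rightarrow> 'a::real_normed_vector"
  assumes "finite I" "\<And>J. J \<subseteq> I \<Longrightarrow> norm (t + sum e J) \<le> M"
    and "\<And>i. i \<in> I \<Longrightarrow> 0 \<le> a i \<and> a i \<le> 1"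
  shows "norm (t + (\<Sum>i\<in>I. a i *\<^sub>R e i)) \<le> M"
  using assms
proof (induction I arbitrary: t rule: finite_induct)
  case empty
  then show ?case by auto
next
  case (insert i I)
  let ?s = "\<Sum>i\<in>I. a i *\<^sub>R e i"
  have 1: "norm (t + ?s) \<le> M"
    using insert by blast
  have 2: "norm ((t + e i) + ?s) \<le> M"
  proof (rule insert.IH)
    fix J assume "J \<subseteq> I"
    then have "finite J" "i \<notin> J" "insert i J \<subseteq> insert i I"
      using insert.hyps finite_subset by auto
    then show "norm (t + e i + sum e J) \<le> M"
      using insert.prems(1)[of "insert i J"] by (simp add: add.assoc)
  qed (use insert in auto)
  have a: "0 \<le> a i" "a i \<le> 1" using insert.prems(2) by auto
  have "t + (\<Sum>i\<in>insert i I. a i *\<^sub>R e i) = (1 - a i) *\<^sub>R (t + ?s) + a i *\<^sub>R ((t + e i) + ?s)"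
    using insert.hyps by (simp add: algebra_simps)
  also have "norm \<dots> \<le> (1 - a i) * norm (t + ?s) + a i * norm ((t + e i) + ?s)"
    using a by (intro norm_triangle_le) simp
  also have "\<dots> \<le> (1 - a i) * M + a i * M"
    using a 1 2 by (intro add_mono mult_left_mono) auto
  finally show ?case by (simp add: algebra_simps)
qed

text \<open>Positive and negative parts, divided by b, are coefficients in the unit interval; the
  factor 2 counts the two parts.\<close>

lemma norm_real_combination_le:
  fixes e :: "'i \<Rightarrow> 'a::real_normed_vector"
  assumes "finite I" "\<And>J. J \<subseteq> I \<Longrightarrow> norm (sum e J) \<le> M"
    and "\<And>i. i \<in> I \<Longrightarrow> \<bar>a i\<bar> \<le> b" "0 \<le> b"
  shows "norm (\<Sum>i\<in>I. a i *\<^sub>R e i) \<le> 2 * M * b"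
proof -
  \<comment> \<open>For b = 0 the quotients are 0 by convention, in agreement with all
    \<open>a i\<close> being 0 then.\<close>
  define p q where "p i = max (a i) 0 / b" and "q i = max (- a i) 0 / b" for i
  have "0 \<le> p i \<and> p i \<le> 1" "0 \<le> q i \<and> q i \<le> 1" if "i \<in> I" for i
    using assms(3)[OF that] assms(4)
    by (auto simp: p_def q_def divide_le_eq_1 max_def)
  then have "norm (\<Sum>i\<in>I. p i *\<^sub>R e i) \<le> M" "norm (\<Sum>i\<in>I. q i *\<^sub>R e i) \<le> M"
    using norm_unit_interval_combination_le[of I 0 e M] assms(1,2) by auto
  moreover have "a i = b * (p i - q i)" if "i \<in> I" for i
    using assms(3)[OF that] by (auto simp: p_def q_def max_def)
  then have "(\<Sum>i\<in>I. a i *\<^sub>R e i) = b *\<^sub>R ((\<Sum>i\<in>I. p i *\<^sub>R e i) - (\<Sum>i\<in>I. q i *\<^sub>R e i))"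
    by (auto simp: scaleR_sum_right sum_subtractf[symmetric] simp flip: scaleR_left_diff_distrib
        intro!: sum.cong)
  ultimately have "norm (\<Sum>i\<in>I. a i *\<^sub>R e i) \<le> b * (M + M)"
    using assms(4) by (simp, intro mult_left_mono norm_triangle_le_diff) auto
  then show ?thesis by (simp add: algebra_simps)
qed

text \<open>Real and imaginary parts are estimated separately, which doubles the real constant. The
  point is that the bound depends on subset sums of e and not on the number of summands.\<close>

lemma norm_complex_combination_le:
  fixes e :: "'i \<Rightarrow> 'a::complex_banach"
  assumes "finite I" "\<And>J. J \<subseteq> I \<Longrightarrow> norm (sum e J) \<le> M"
    and "\<And>i. i \<in> I \<Longrightarrow> cmod (c i) \<le> b" "0 \<le> b"
  shows "norm (\<Sum>i\<in>I. c i *\<^sub>C e i) \<le> 4 * M * b"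
proof -
  have "c i *\<^sub>C e i = Re (c i) *\<^sub>R e i + \<i> *\<^sub>C (Im (c i) *\<^sub>R e i)" for i
    using complex_eq[of "c i"]
    by (metis scaleC_add_left scaleC_of_real scaleC_scaleC)
  then have "(\<Sum>i\<in>I. c i *\<^sub>C e i) = (\<Sum>i\<in>I. Re (c i) *\<^sub>R e i) + \<i> *\<^sub>C (\<Sum>i\<in>I. Im (c i) *\<^sub>R e i)"
    by (simp add: sum.distrib scaleC.sum_right)
  moreover have "norm (\<Sum>i\<in>I. Re (c i) *\<^sub>R e i) \<le> 2 * M * b" "norm (\<Sum>i\<in>I. Im (c i) *\<^sub>R e i) \<le> 2 * M * b"
    using assms by (auto intro!: norm_real_combination_le
        intro: order_trans[OF abs_Re_le_cmod] order_trans[OF abs_Im_le_cmod])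
  ultimately show ?thesis
    using norm_triangle_ineq[of "\<Sum>i\<in>I. Re (c i) *\<^sub>R e i" "\<i> *\<^sub>C (\<Sum>i\<in>I. Im (c i) *\<^sub>R e i)"]
    by (simp add: norm_scaleC)
qed

section \<open>Spectral measures\<close>

locale spectral_meas =
  fixes E :: "complex set \<Rightarrow> ('a::complex_banach \<Rightarrow>\<^sub>L 'a)"
  assumes spectral_measure: "spectral_measure E"
begin

lemma E_empty [simp]: "E {} = 0" and E_UNIV [simp]: "E UNIV = id_blinfun"
  using spectral_measure by (auto simp: spectral_measure_def)

lemma complex_linear_E: "\<delta> \<in> sets borel \<Longrightarrow> complex_linear (E \<delta>)"
  using spectral_measure by (auto simp: spectral_measure_def)

lemma E_Int: "\<delta> \<in> sets borel \<Longrightarrow> \<epsilon> \<in> sets borel \<Longrightarrow> E (\<delta> \<inter> \<epsilon>) = E \<delta> o\<^sub>L E \<epsilon>"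
  using spectral_measure by (auto simp: spectral_measure_def)

lemma E_apply_E: "\<delta> \<in> sets borel \<Longrightarrow> \<epsilon> \<in> sets borel \<Longrightarrow> E \<delta> (E \<epsilon> x) = E (\<delta> \<inter> \<epsilon>) x"
  by (simp add: E_Int)

lemma E_sums:
  assumes "range \<delta> \<subseteq> sets borel" "disjoint_family (\<delta> :: nat \<Rightarrow> _)"
  shows "(\<lambda>n. E (\<delta> n) x) sums E (\<Union>n. \<delta> n) x"
  using spectral_measure assms unfolding spectral_measure_def by blast

text \<open>Additivity is given only for sequences; the pair is padded with empty sets, on which E
  is 0.\<close>

lemma E_Un:
  assumes "\<delta> \<in> sets borel" "\<epsilon> \<in> sets borel" "\<delta> \<inter> \<epsilon> = {}"
  shows "E (\<delta> \<union> \<epsilon>) = E \<delta> + E \<epsilon>"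
proof (rule blinfun_eqI)
  fix x
  define D where "D n = (if n = 0 then \<delta> else if n = Suc 0 then \<epsilon> else {})" for n :: nat
  have "range D \<subseteq> sets borel" "disjoint_family D"
    using assms by (auto simp: D_def disjoint_family_on_def)
  then have "(\<lambda>n. E (D n) x) sums E (\<Union>n. D n) x" by (rule E_sums)
  moreover have "(\<lambda>n. E (D n) x) sums (\<Sum>n\<in>{0, Suc 0}. E (D n) x)"
    by (rule sums_finite) (auto simp: D_def)
  moreover have "(\<Union>n. D n) = \<delta> \<union> \<epsilon>"
    by (auto simp: D_def split: if_splits)
  ultimately have "E (\<delta> \<union> \<epsilon>) x = (\<Sum>n\<in>{0, Suc 0}. E (D n) x)"
    using sums_unique2 by metis
  then show "E (\<delta> \<union> \<epsilon>) x = (E \<delta> + E \<epsilon>) x"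
    by (simp add: D_def plus_blinfun.rep_eq)
qed

lemma E_finite_UN:
  assumes "finite I" "\<And>i. i \<in> I \<Longrightarrow> D i \<in> sets borel" "disjoint_family_on D I"
  shows "E (\<Union>i\<in>I. D i) = (\<Sum>i\<in>I. E (D i))"
  using assms
proof (induction I rule: finite_induct)
  case (insert i I)
  have "E (D i \<union> (\<Union>i\<in>I. D i)) = E (D i) + E (\<Union>i\<in>I. D i)"
    using insert by (intro E_Un) (auto simp: disjoint_family_on_insert)
  then show ?case
    using insert by (simp add: disjoint_family_on_insert)
qed simp

lemma E_Diff:
  assumes "\<delta> \<in> sets borel" "\<epsilon> \<in> sets borel" "\<delta> \<subseteq> \<epsilon>"
  shows "E (\<epsilon> - \<delta>) = E \<epsilon> - E \<delta>"
  using E_Un[of \<delta> "\<epsilon> - \<delta>"] assms by (simp add: Un_absorb1 algebra_simps)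

lemma E_Compl: "\<delta> \<in> sets borel \<Longrightarrow> E (- \<delta>) = id_blinfun - E \<delta>"
  using E_Diff[of \<delta> UNIV] by (simp add: Compl_eq_Diff_UNIV)

lemma E_null_mono: "\<lbrakk>E \<epsilon> = 0; \<delta> \<subseteq> \<epsilon>; \<delta> \<in> sets borel; \<epsilon> \<in> sets borel\<rbrakk> \<Longrightarrow> E \<delta> = 0"
  using E_Int[of \<delta> \<epsilon>] by (simp add: Int_absorb2)

text \<open>Strong continuity from below: the sum over the disjoint increments telescopes. All
  approximations of vectors below come from this.\<close>

lemma E_incseq:
  assumes "range D \<subseteq> sets borel" "incseq D"
  shows "(\<lambda>n. E (D n) x) \<longlonglongrightarrow> E (\<Union>n. D n) x"
proof -
  have D: "D n \<in> sets borel" for n using assms(1) by auto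
  have d: "range (disjointed D) \<subseteq> sets borel"
    using assms(1) by (rule sets.range_disjointed_sets)
  have "(\<lambda>n. E (disjointed D n) x) sums E (\<Union>n. disjointed D n) x"
    by (rule E_sums[OF d disjoint_family_disjointed])
  then have "(\<lambda>n. \<Sum>k\<le>n. E (disjointed D k) x) \<longlonglongrightarrow> E (\<Union>n. D n) x"
    by (simp add: sums_def_le UN_disjointed_eq)
  moreover have "(\<Sum>k\<le>n. E (disjointed D k)) = E (D n)" for n
  proof (induction n)
    case 0
    then show ?case by (simp add: disjointed_def)
  next
    case (Suc n)
    have "disjointed D (Suc n) = D (Suc n) - D n"
      using assms(2) by (rule disjointed_mono)
    with Suc show ?case
      using E_Diff[OF D D, of n "Suc n"] incseq_SucD[OF assms(2)] by simp
  qed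
  ultimately show ?thesis by (simp flip: blinfun.sum_left)
qed

lemma E_countable_null:
  assumes "countable \<D>" "\<And>D. D \<in> \<D> \<Longrightarrow> D \<in> sets borel \<and> E D = 0"
  shows "E (\<Union>\<D>) = 0"
proof (cases "\<D> = {}")
  case False
  define D where "D = from_nat_into \<D>"
  have D: "D n \<in> sets borel" "E (D n) = 0" for n
    using assms(2) from_nat_into[OF False] by (auto simp: D_def)
  have "\<Union>\<D> = (\<Union>n. D n)"
    using False assms(1) by (simp add: D_def range_from_nat_into)
  moreover have d: "range (disjointed D) \<subseteq> sets borel"
    using D by (intro sets.range_disjointed_sets) auto
  moreover have "E (disjointed D n) = 0" for n
    using D d by (intro E_null_mono[OF D(2), of "disjointed D n" n] disjointed_subset) auto
  ultimately have "(\<lambda>n. 0) sums E (\<Union>\<D>) x" for x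
    using E_sums[OF d disjoint_family_disjointed, of x] by (simp add: UN_disjointed_eq)
  from sums_unique2[OF this sums_zero] show ?thesis
    by (intro blinfun_eqI) simp
qed simp

text \<open>For fixed x the vector measure \<open>E \<delta> x\<close> tends to 0 along disjoint
  sequences, being the terms of a convergent series, so it is bounded. The uniform boundedness
  principle then removes the dependence on x.\<close>

lemma E_bounded_ex: "\<exists>M\<ge>0. \<forall>\<delta>\<in>sets borel. norm (E \<delta>) \<le> M"
proof -
  have "\<exists>K. \<forall>\<delta>\<in>sets borel. norm (E \<delta> x) \<le> K" for x
  proof (rule exhaustive_imp_bounded[of UNIV])
    show "sigma_algebra UNIV (sets borel :: complex set set)"
      using sets.sigma_algebra_axioms[of "borel :: complex measure"] by simp
    show "(\<lambda>n. E (D n) x) \<longlonglongrightarrow> 0" if "range D \<subseteq> sets borel" "disjoint_family D" for D :: "nat \<Rightarrow> _"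
      using E_sums[OF that] by (intro summable_LIMSEQ_zero sums_summable)
  qed (simp add: E_Un plus_blinfun.rep_eq)
  then have "\<exists>M. \<forall>T\<in>E ` sets borel. norm (blinfun_apply T x) \<le> M" for x by auto
  from uniform_boundedness[OF this] show ?thesis by auto
qed

definition E_bound :: real where "E_bound = (SOME M. M \<ge> 0 \<and> (\<forall>\<delta>\<in>sets borel. norm (E \<delta>) \<le> M))"

lemma E_bound_nonneg: "E_bound \<ge> 0"
  and norm_E_le: "\<delta> \<in> sets borel \<Longrightarrow> norm (E \<delta>) \<le> E_bound"
  using someI_ex[of "\<lambda>M. M \<ge> 0 \<and> (\<forall>\<delta>\<in>sets borel. norm (E \<delta>) \<le> M)"] E_bounded_ex
  unfolding E_bound_def by blast+

end

section \<open>The integral of bounded functions\<close>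

lemma simple_function_level_sets:
  assumes "S \<in> sets borel" "simple_function (restrict_space borel S) s"
  shows "finite (s ` S)" "{z \<in> S. P (s z)} \<in> sets borel"
proof -
  show fin: "finite (s ` S)"
    using simple_functionD(1)[OF assms(2)] by (simp add: space_restrict_space)
  have "{z \<in> S. P (s z)} = s -` {c. P c} \<inter> space (restrict_space borel S)"
    by (auto simp: space_restrict_space)
  also have "\<dots> \<in> sets (restrict_space borel S)"
    using assms(2) by (rule simple_functionD(2))
  finally show "{z \<in> S. P (s z)} \<in> sets borel"
    using assms(1) by (auto simp: sets_restrict_space)
qed

lemma bounded_borel_uniform_simple_approx:
  fixes G :: "complex \<Rightarrow> complex"
  assumes "G \<in> borel_measurable (restrict_space borel S)" "bounded (G ` S)"
  shows "\<exists>s. (\<forall>n. simple_function (restrict_space borel S) (s n)) \<and> uniform_limit S s G sequentially"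
proof -
  \<comment> \<open>Rounding down to the grid of mesh 1/(n+1). Applied to real and imaginary parts
    it gives finitely many values, because G is bounded on S.\<close>
  define q where "q n x = real_of_int \<lfloor>real (Suc n) * x\<rfloor> / real (Suc n)" for n and x :: real
  define s where "s n z = Complex (q n (Re (G z))) (q n (Im (G z)))" for n z
  have q: "\<bar>q n x - x\<bar> \<le> 1 / real (Suc n)" for n x
  proof -
    have "q n x - x = (real_of_int \<lfloor>real (Suc n) * x\<rfloor> - real (Suc n) * x) / real (Suc n)"
      by (simp add: q_def diff_divide_distrib)
    moreover have "\<bar>real_of_int \<lfloor>real (Suc n) * x\<rfloor> - real (Suc n) * x\<bar> \<le> 1"
      by linarith
    ultimately show ?thesis by (simp add: divide_right_mono)
  qed
  obtain b where b: "\<And>z. z \<in> S \<Longrightarrow> cmod (G z) \<le> b"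
    using assms(2) by (auto simp: bounded_iff)
  have "simple_function (restrict_space borel S) (s n)" for n
  proof (rule simple_function_borel_measurable)
    have "(\<lambda>z. Complex (q n (Re (G z))) (q n (Im (G z)))) =
        (\<lambda>z. of_real (q n (Re (G z))) + \<i> * of_real (q n (Im (G z))))"
      by (simp add: complex_eq_iff fun_eq_iff)
    moreover have "(\<lambda>z. of_real (q n (Re (G z))) + \<i> * of_real (q n (Im (G z))))
        \<in> borel_measurable (restrict_space borel S)"
      unfolding q_def using assms(1) by measurable
    ultimately show "s n \<in> borel_measurable (restrict_space borel S)"
      unfolding s_def by simp
    define N where "N = \<lceil>real (Suc n) * b\<rceil> + 1"
    have fl: "\<lfloor>real (Suc n) * x\<rfloor> \<in> {-N..N}" if "\<bar>x\<bar> \<le> b" for x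
    proof -
      have "\<bar>real (Suc n) * x\<bar> \<le> real (Suc n) * b"
        using that by (simp add: abs_mult mult_left_mono)
      then have "- (real (Suc n) * b) \<le> real (Suc n) * x" "real (Suc n) * x \<le> real (Suc n) * b"
        by (auto simp only: abs_le_iff minus_le_iff)
      then show ?thesis unfolding N_def atLeastAtMost_iff by linarith
    qed
    let ?f = "\<lambda>(i, j). Complex (real_of_int i / real (Suc n)) (real_of_int j / real (Suc n))"
    have "s n ` space (restrict_space borel S) \<subseteq> ?f ` ({-N..N} \<times> {-N..N})"
    proof safe
      fix z assume "z \<in> space (restrict_space borel S)"
      then have "\<bar>Re (G z)\<bar> \<le> b" "\<bar>Im (G z)\<bar> \<le> b"
        using b[of z] abs_Re_le_cmod[of "G z"] abs_Im_le_cmod[of "G z"]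
        by (auto simp: space_restrict_space)
      then have "(\<lfloor>real (Suc n) * Re (G z)\<rfloor>, \<lfloor>real (Suc n) * Im (G z)\<rfloor>) \<in> {-N..N} \<times> {-N..N}"
        using fl by blast
      then show "s n z \<in> ?f ` ({-N..N} \<times> {-N..N})"
        unfolding s_def q_def by (rule rev_image_eqI) simp
    qed
    then show "finite (s n ` space (restrict_space borel S))"
      by (rule finite_subset) simp
  qed
  moreover have "uniform_limit S s G sequentially"
  proof (rule uniform_limitI)
    fix e :: real assume "e > 0"
    have "dist (s n z) (G z) \<le> 2 / real (Suc n)" for n z
    proof -
      have "dist (s n z) (G z) \<le> \<bar>Re (s n z - G z)\<bar> + \<bar>Im (s n z - G z)\<bar>"
        unfolding dist_norm by (rule cmod_le)
      also have "\<dots> \<le> 2 / real (Suc n)"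
        using q[of n "Re (G z)"] q[of n "Im (G z)"] by (simp add: s_def)
      finally show ?thesis .
    qed
    moreover have "(\<lambda>n. 2 / real (Suc n)) \<longlonglongrightarrow> 0"
      by (rule LIMSEQ_Suc) (rule lim_const_over_n)
    then have "eventually (\<lambda>n. 2 / real (Suc n) < e) sequentially"
      using \<open>e > 0\<close> by (rule order_tendstoD)
    ultimately show "\<forall>\<^sub>F n in sequentially. \<forall>x\<in>S. dist (s n x) (G x) < e"
      by (elim eventually_mono) (meson le_less_trans)
  qed
  ultimately show ?thesis by blast
qed

section \<open>Integrals of simple functions: norm estimate, linearity and multiplicativity\<close>

context spectral_meas
begin

text \<open>Frees the integral from the level sets of s: any finite Borel partition on whose cells s
  is constant will do. Cells sharing a value are merged by finite additivity.\<close>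

lemma simple_integral_partition:
  assumes "S \<in> sets borel" "finite (h ` S)" "\<And>p. {z \<in> S. h z = p} \<in> sets borel"
    and "\<And>z. z \<in> S \<Longrightarrow> s z = a (h z)"
  shows "simple_spectral_integral E S s = (\<Sum>p\<in>h ` S. a p *\<^sub>C E {z \<in> S. h z = p})"
proof -
  have im: "s ` S = a ` (h ` S)" using assms(4) by auto
  have "simple_spectral_integral E S s
      = (\<Sum>c\<in>a ` (h ` S). \<Sum>p\<in>{p \<in> h ` S. a p = c}. a p *\<^sub>C E {z \<in> S. h z = p})"
    unfolding simple_spectral_integral_def im
  proof (rule sum.cong[OF refl])
    fix c
    have "{z \<in> S. s z = c} = (\<Union>p\<in>{p \<in> h ` S. a p = c}. {z \<in> S. h z = p})"
      using assms(4) by auto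
    then have "E {z \<in> S. s z = c} = (\<Sum>p\<in>{p \<in> h ` S. a p = c}. E {z \<in> S. h z = p})"
      using assms(2,3) by (simp, intro E_finite_UN) (auto simp: disjoint_family_on_def)
    then show "c *\<^sub>C E {z \<in> S. s z = c} = (\<Sum>p\<in>{p \<in> h ` S. a p = c}. a p *\<^sub>C E {z \<in> S. h z = p})"
      by (simp add: scaleC.sum_right)
  qed
  also have "\<dots> = (\<Sum>p\<in>h ` S. a p *\<^sub>C E {z \<in> S. h z = p})"
    by (rule sum.image_gen[symmetric]) (rule assms(2))
  finally show ?thesis .
qed

text \<open>A subset sum of the projections is again a value of E, on the union of the level sets
  concerned, so \<open>E_bound\<close> bounds all subset sums at once.\<close>

lemma simple_integral_norm_le:
  assumes S: "S \<in> sets borel" and s: "simple_function (restrict_space borel S) s"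
    and b: "\<And>z. z \<in> S \<Longrightarrow> cmod (s z) \<le> b" "0 \<le> b"
  shows "norm (simple_spectral_integral E S s) \<le> 4 * E_bound * b"
  unfolding simple_spectral_integral_def
proof (rule norm_complex_combination_le)
  note L = simple_function_level_sets[OF S s]
  show "finite (s ` S)" by (rule L)
  show "norm (\<Sum>c\<in>J. E {z \<in> S. s z = c}) \<le> E_bound" if "J \<subseteq> s ` S" for J
  proof -
    have "(\<Sum>c\<in>J. E {z \<in> S. s z = c}) = E (\<Union>c\<in>J. {z \<in> S. s z = c})"
      using that L by (intro E_finite_UN[symmetric]) (auto simp: disjoint_family_on_def intro: finite_subset)
    also have "(\<Union>c\<in>J. {z \<in> S. s z = c}) = {z \<in> S. s z \<in> J}" by auto
    finally show ?thesis using norm_E_le L(2)[of "\<lambda>c. c \<in> J"] by simp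
  qed
qed (use b in auto)

lemma simple_integral_complex_linear:
  assumes "S \<in> sets borel" "simple_function (restrict_space borel S) s"
  shows "complex_linear (simple_spectral_integral E S s)"
  unfolding simple_spectral_integral_def
  using simple_function_level_sets[OF assms]
  by (intro complex_linear_sum complex_linear_scaleC complex_linear_E) auto

text \<open>A common refinement of the level sets of s and t. The cells do not depend on a, so sum,
  difference, product and both factors can be expanded over the same index set.\<close>

lemma simple_integral_pair:
  assumes S: "S \<in> sets borel" and "simple_function (restrict_space borel S) s"
    and "simple_function (restrict_space borel S) t"
  obtains I D where "finite I" "\<And>p. D p \<in> sets borel" "disjoint_family_on D I"
    "\<And>a. simple_spectral_integral E S (\<lambda>z. a (s z) (t z)) = (\<Sum>(c, d)\<in>I. a c d *\<^sub>C E (D (c, d)))"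
proof
  let ?h = "\<lambda>z. (s z, t z)"
  have sf: "simple_function (restrict_space borel S) ?h"
    using assms by (intro simple_function_Pair)
  have fin: "finite (?h ` S)"
    using simple_functionD(1)[OF sf] by (simp add: space_restrict_space)
  have "{z \<in> S. ?h z = p} = ?h -` {p} \<inter> space (restrict_space borel S)" for p
    by (auto simp: space_restrict_space)
  moreover have "?h -` {p} \<inter> space (restrict_space borel S) \<in> sets (restrict_space borel S)" for p
    using sf by (rule simple_functionD(2))
  ultimately have m: "{z \<in> S. ?h z = p} \<in> sets borel" for p
    using S by (metis (no_types, lifting) sets.Int_space_eq2 sets_restrict_space_iff space_borel inf_top_right)
  show "finite (?h ` S)" "\<And>p. {z \<in> S. ?h z = p} \<in> sets borel"
    by (rule fin m)+
  show "disjoint_family_on (\<lambda>p. {z \<in> S. ?h z = p}) (?h ` S)"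
    by (auto simp: disjoint_family_on_def)
  show "simple_spectral_integral E S (\<lambda>z. a (s z) (t z))
      = (\<Sum>(c, d)\<in>?h ` S. a c d *\<^sub>C E {z \<in> S. ?h z = (c, d)})" for a
    using simple_integral_partition[OF S fin m, of "\<lambda>z. a (s z) (t z)" "\<lambda>(c, d). a c d"]
    by (simp add: case_prod_unfold prod_eq_iff)
qed

lemma simple_integral_add:
  assumes "S \<in> sets borel" "simple_function (restrict_space borel S) s"
    "simple_function (restrict_space borel S) t"
  shows "simple_spectral_integral E S (\<lambda>z. s z + t z)
       = simple_spectral_integral E S s + simple_spectral_integral E S t"
proof -
  obtain I D where "finite I" "\<And>p. D p \<in> sets borel" "disjoint_family_on D I"
    and *: "\<And>a. simple_spectral_integral E S (\<lambda>z. a (s z) (t z)) = (\<Sum>(c, d)\<in>I. a c d *\<^sub>C E (D (c, d)))"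
    by (rule simple_integral_pair[OF assms]) (rule that)
  show ?thesis
    using *[of "\<lambda>c d. c + d"] *[of "\<lambda>c d. c"] *[of "\<lambda>c d. d"]
    by (simp add: scaleC_add_left sum.distrib case_prod_unfold)
qed

lemma simple_integral_diff:
  assumes "S \<in> sets borel" "simple_function (restrict_space borel S) s"
    "simple_function (restrict_space borel S) t"
  shows "simple_spectral_integral E S (\<lambda>z. s z - t z)
       = simple_spectral_integral E S s - simple_spectral_integral E S t"
proof -
  obtain I D where "finite I" "\<And>p. D p \<in> sets borel" "disjoint_family_on D I"
    and *: "\<And>a. simple_spectral_integral E S (\<lambda>z. a (s z) (t z)) = (\<Sum>(c, d)\<in>I. a c d *\<^sub>C E (D (c, d)))"
    by (rule simple_integral_pair[OF assms]) (rule that)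
  show ?thesis
    using *[of "\<lambda>c d. c - d"] *[of "\<lambda>c d. c"] *[of "\<lambda>c d. d"]
    by (simp add: scaleC.diff_left sum_subtractf case_prod_unfold)
qed

lemma simple_integral_mult:
  assumes "S \<in> sets borel" "simple_function (restrict_space borel S) s"
    "simple_function (restrict_space borel S) t"
  shows "simple_spectral_integral E S (\<lambda>z. s z * t z)
       = simple_spectral_integral E S s o\<^sub>L simple_spectral_integral E S t"
proof -
  obtain I D where I: "finite I" and D: "\<And>p. D p \<in> sets borel" "disjoint_family_on D I"
    and *: "\<And>a. simple_spectral_integral E S (\<lambda>z. a (s z) (t z)) = (\<Sum>(c, d)\<in>I. a c d *\<^sub>C E (D (c, d)))"
    by (rule simple_integral_pair[OF assms]) (rule that)
  have "simple_spectral_integral E S s o\<^sub>L simple_spectral_integral E S t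
      = (\<Sum>p\<in>I. \<Sum>q\<in>I. (fst p *\<^sub>C E (D p)) o\<^sub>L (snd q *\<^sub>C E (D q)))"
    using *[of "\<lambda>c d. c"] *[of "\<lambda>c d. d"]
    by (simp add: bounded_bilinear.sum_left[OF bounded_bilinear_blinfun_compose]
        bounded_bilinear.sum_right[OF bounded_bilinear_blinfun_compose] case_prod_unfold)
      (rule sum.swap)
  \<comment> \<open>Distinct cells are disjoint, so their projections multiply to
    \<open>E {} = 0\<close> and only the diagonal of the double sum survives.\<close>
  also have "\<dots> = (\<Sum>p\<in>I. \<Sum>q\<in>I. if q = p then (fst p * snd p) *\<^sub>C E (D p) else 0)"
  proof (intro sum.cong refl)
    fix p q assume "p \<in> I" "q \<in> I"
    then have "D p \<inter> D q = (if q = p then D p else {})"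
      using D(2) by (auto simp: disjoint_family_on_def)
    then show "(fst p *\<^sub>C E (D p)) o\<^sub>L (snd q *\<^sub>C E (D q))
        = (if q = p then (fst p * snd p) *\<^sub>C E (D p) else 0)"
      by (auto simp: scaleC_compose complex_linear_E D scaleC.zero_right simp flip: E_Int)
  qed
  also have "\<dots> = (\<Sum>p\<in>I. (fst p * snd p) *\<^sub>C E (D p))"
    using I by simp
  finally show ?thesis
    using *[of "\<lambda>c d. c * d"] by (simp add: case_prod_unfold)
qed

end

text \<open>The relation under the definite description in \<open>bounded_spectral_integral\<close>.
  Stating the algebra for the relation allows it to precede existence and uniqueness; uniqueness is
  in fact deduced from the rule for differences.\<close>

definition spectral_limit ::
    "(complex set \<Rightarrow> ('a::complex_banach \<Rightarrow>\<^sub>L 'a)) \<Rightarrow> complex set \<Rightarrow> (complex \<Rightarrow> complex) \<Rightarrow> ('a \<Rightarrow>\<^sub>L 'a) \<Rightarrow> bool"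
  where
  "spectral_limit E S G T \<longleftrightarrow>
     (\<exists>s :: nat \<Rightarrow> complex \<Rightarrow> complex.
        (\<forall>n. simple_function (restrict_space borel S) (s n)) \<and>
        uniform_limit S s G sequentially \<and>
        (\<lambda>n. simple_spectral_integral E S (s n)) \<longlonglongrightarrow> T)"

lemma spectral_limitE:
  assumes "spectral_limit E S G T"
  obtains s where "\<And>n. simple_function (restrict_space borel S) (s n)"
    "uniform_limit S s G sequentially" "(\<lambda>n. simple_spectral_integral E S (s n)) \<longlonglongrightarrow> T"
  using assms unfolding spectral_limit_def by blast

lemma bounded_spectral_integral_altdef: "bounded_spectral_integral E S G = (THE T. spectral_limit E S G T)"
  by (simp add: bounded_spectral_integral_def spectral_limit_def)

lemma spectral_limit_cong:
  assumes "\<And>z. z \<in> S \<Longrightarrow> G z = H z"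
  shows "spectral_limit E S G = spectral_limit E S H"
proof -
  have "uniform_limit S s G sequentially = uniform_limit S s H sequentially" for s :: "nat \<Rightarrow> _"
    by (rule uniform_limit_cong') (use assms in auto)
  then show ?thesis by (intro ext) (simp add: spectral_limit_def)
qed

definition bounded_borel :: "(complex \<Rightarrow> complex) \<Rightarrow> bool" where
  "bounded_borel g \<longleftrightarrow> g \<in> borel_measurable borel \<and> bounded (range g)"

lemma bounded_borelI:
  assumes "g \<in> borel_measurable borel" "\<And>z. cmod (g z) \<le> b"
  shows "bounded_borel g"
  using assms by (auto simp: bounded_borel_def bounded_iff)

lemma bounded_borelE:
  assumes "bounded_borel g"
  obtains b where "g \<in> borel_measurable borel" "0 \<le> b" "\<And>z. cmod (g z) \<le> b"
proof -
  from assms obtain b where "g \<in> borel_measurable borel" "\<And>z. cmod (g z) \<le> b"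
    by (auto simp: bounded_borel_def bounded_iff)
  then show thesis using that[of b] order_trans[OF norm_ge_zero, of "g 0" b] by simp
qed

lemma bounded_borel_indicator: "\<delta> \<in> sets borel \<Longrightarrow> bounded_borel (indicator \<delta>)"
  by (rule bounded_borelI[where b = 1]) (auto simp: indicator_def)

lemma bounded_borel_add:
  assumes "bounded_borel g" "bounded_borel h"
  shows "bounded_borel (\<lambda>z. g z + h z)"
proof -
  obtain b where b: "g \<in> borel_measurable borel" "0 \<le> b" "\<And>z. cmod (g z) \<le> b"
    by (rule bounded_borelE[OF assms(1)]) (rule that)
  obtain c where c: "h \<in> borel_measurable borel" "0 \<le> c" "\<And>z. cmod (h z) \<le> c"
    by (rule bounded_borelE[OF assms(2)]) (rule that)
  show ?thesis
    by (rule bounded_borelI[where b = "b + c"]) (simp_all add: borel_measurable_add norm_triangle_mono b c)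
qed

lemma bounded_borel_mult:
  assumes "bounded_borel g" "bounded_borel h"
  shows "bounded_borel (\<lambda>z. g z * h z)"
proof -
  obtain b where b: "g \<in> borel_measurable borel" "0 \<le> b" "\<And>z. cmod (g z) \<le> b"
    by (rule bounded_borelE[OF assms(1)]) (rule that)
  obtain c where c: "h \<in> borel_measurable borel" "0 \<le> c" "\<And>z. cmod (h z) \<le> c"
    by (rule bounded_borelE[OF assms(2)]) (rule that)
  show ?thesis
    by (rule bounded_borelI[where b = "b * c"]) (simp_all add: borel_measurable_times norm_mult mult_mono b c)
qed

lemma bounded_borel_cmult: "bounded_borel g \<Longrightarrow> bounded_borel (\<lambda>z. c * g z)"
  by (rule bounded_borel_mult[where g = "\<lambda>_. c"]) (auto simp: bounded_borel_def)

context spectral_meas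
begin

lemma spectral_limit_norm_le:
  assumes S: "S \<in> sets borel" and T: "spectral_limit E S G T"
    and b: "\<And>z. z \<in> S \<Longrightarrow> cmod (G z) \<le> b" "0 \<le> b"
  shows "norm T \<le> 4 * E_bound * b"
proof (rule field_le_epsilon)
  fix e :: real assume "e > 0"
  \<comment> \<open>The summand 1 keeps the denominator positive when \<open>E_bound\<close> is
    0.\<close>
  define d where "d = e / (4 * E_bound + 1)"
  have d: "d > 0" "4 * E_bound * d \<le> e"
    using E_bound_nonneg \<open>e > 0\<close> by (auto simp: d_def field_simps)
  obtain s where s: "\<And>n. simple_function (restrict_space borel S) (s n)"
    "uniform_limit S s G sequentially" "(\<lambda>n. simple_spectral_integral E S (s n)) \<longlonglongrightarrow> T"
    using T by (auto simp: spectral_limit_def)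
  have "\<forall>\<^sub>F n in sequentially. \<forall>z\<in>S. dist (s n z) (G z) < d"
    using s(2) d(1) by (rule uniform_limitD)
  then have "\<forall>\<^sub>F n in sequentially. norm (simple_spectral_integral E S (s n)) \<le> 4 * E_bound * (b + d)"
  proof (rule eventually_mono)
    fix n assume *: "\<forall>z\<in>S. dist (s n z) (G z) < d"
    have "cmod (s n z) \<le> b + d" if "z \<in> S" for z
    proof -
      have "dist (s n z) (G z) < d" using * that by blast
      then show ?thesis
        using b(1)[OF that] norm_triangle_sub[of "s n z" "G z"] by (simp add: dist_norm)
    qed
    then show "norm (simple_spectral_integral E S (s n)) \<le> 4 * E_bound * (b + d)"
      using b(2) d(1) by (intro simple_integral_norm_le S s(1)) auto
  qed
  then have "norm T \<le> 4 * E_bound * (b + d)"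
    by (rule tendsto_upperbound[OF tendsto_norm[OF s(3)]]) simp
  then show "norm T \<le> 4 * E_bound * b + e"
    using d(2) by (simp add: algebra_simps)
qed

lemma spectral_limit_add:
  assumes "S \<in> sets borel" "spectral_limit E S G T" "spectral_limit E S H U"
  shows "spectral_limit E S (\<lambda>z. G z + H z) (T + U)"
proof -
  obtain s where s: "\<And>n. simple_function (restrict_space borel S) (s n)"
    "uniform_limit S s G sequentially" "(\<lambda>n. simple_spectral_integral E S (s n)) \<longlonglongrightarrow> T"
    by (rule spectral_limitE[OF assms(2)]) (rule that)
  obtain t where t: "\<And>n. simple_function (restrict_space borel S) (t n)"
    "uniform_limit S t H sequentially" "(\<lambda>n. simple_spectral_integral E S (t n)) \<longlonglongrightarrow> U"
    by (rule spectral_limitE[OF assms(3)]) (rule that)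
  show ?thesis
    unfolding spectral_limit_def
    by (rule exI[of _ "\<lambda>n z. s n z + t n z"])
      (use s t assms(1) in \<open>simp add: simple_integral_add uniform_limit_add tendsto_add\<close>)
qed

lemma spectral_limit_diff:
  assumes "S \<in> sets borel" "spectral_limit E S G T" "spectral_limit E S H U"
  shows "spectral_limit E S (\<lambda>z. G z - H z) (T - U)"
proof -
  obtain s where s: "\<And>n. simple_function (restrict_space borel S) (s n)"
    "uniform_limit S s G sequentially" "(\<lambda>n. simple_spectral_integral E S (s n)) \<longlonglongrightarrow> T"
    by (rule spectral_limitE[OF assms(2)]) (rule that)
  obtain t where t: "\<And>n. simple_function (restrict_space borel S) (t n)"
    "uniform_limit S t H sequentially" "(\<lambda>n. simple_spectral_integral E S (t n)) \<longlonglongrightarrow> U"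
    by (rule spectral_limitE[OF assms(3)]) (rule that)
  show ?thesis
    unfolding spectral_limit_def
    by (rule exI[of _ "\<lambda>n z. s n z - t n z"])
      (use s t assms(1) in \<open>simp add: simple_integral_diff uniform_limit_minus tendsto_diff\<close>)
qed

lemma spectral_limit_mult:
  assumes "S \<in> sets borel" "spectral_limit E S G T" "spectral_limit E S H U"
    and "bounded (G ` S)" "bounded (H ` S)"
  shows "spectral_limit E S (\<lambda>z. G z * H z) (T o\<^sub>L U)"
proof -
  obtain s where s: "\<And>n. simple_function (restrict_space borel S) (s n)"
    "uniform_limit S s G sequentially" "(\<lambda>n. simple_spectral_integral E S (s n)) \<longlonglongrightarrow> T"
    by (rule spectral_limitE[OF assms(2)]) (rule that)
  obtain t where t: "\<And>n. simple_function (restrict_space borel S) (t n)"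
    "uniform_limit S t H sequentially" "(\<lambda>n. simple_spectral_integral E S (t n)) \<longlonglongrightarrow> U"
    by (rule spectral_limitE[OF assms(3)]) (rule that)
  show ?thesis
    unfolding spectral_limit_def
    by (rule exI[of _ "\<lambda>n z. s n z * t n z"])
      (use s t assms(1,4,5) in \<open>simp add: simple_integral_mult uniform_lim_mult
        bounded_bilinear.tendsto[OF bounded_bilinear_blinfun_compose]\<close>)
qed

lemma spectral_limit_simple:
  "simple_function (restrict_space borel S) s \<Longrightarrow> spectral_limit E S s (simple_spectral_integral E S s)"
  unfolding spectral_limit_def by (rule exI[of _ "\<lambda>_. s"]) (auto intro: uniform_limit_const)

lemma spectral_limit_complex_linear:
  "S \<in> sets borel \<Longrightarrow> spectral_limit E S G T \<Longrightarrow> complex_linear T"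
  by (erule spectral_limitE) (rule complex_linear_LIMSEQ, rule simple_integral_complex_linear)

text \<open>The difference of two limits is a limit for the integrand 0, and the norm estimate with
  b = 0 makes it vanish.\<close>

lemma spectral_limit_unique:
  assumes "S \<in> sets borel" "spectral_limit E S G T" "spectral_limit E S G U"
  shows "T = U"
  using spectral_limit_norm_le[OF assms(1) spectral_limit_diff[OF assms], of 0] by simp

lemma bounded_spectral_integral_eqI:
  "S \<in> sets borel \<Longrightarrow> spectral_limit E S G T \<Longrightarrow> bounded_spectral_integral E S G = T"
  unfolding bounded_spectral_integral_altdef
  by (rule the_equality) (auto intro: spectral_limit_unique)

lemma spectral_limit_exists:
  assumes S: "S \<in> sets borel"
    and "G \<in> borel_measurable (restrict_space borel S)" "bounded (G ` S)"
  shows "\<exists>T. spectral_limit E S G T"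
proof -
  obtain s where s: "\<And>n. simple_function (restrict_space borel S) (s n)"
    and lim: "uniform_limit S s G sequentially"
    using bounded_borel_uniform_simple_approx[OF assms(2,3)] by auto
  have "Cauchy (\<lambda>n. simple_spectral_integral E S (s n))"
  proof (rule CauchyI)
    fix e :: real assume "e > 0"
    \<comment> \<open>Two approximants within d of G differ by at most 2 d, and the norm estimate
      multiplies this by 4 \<open>E_bound\<close>; this explains the 8.\<close>
    define d where "d = e / (8 * E_bound + 1)"
    have d: "d > 0" "4 * E_bound * (2 * d) < e"
      using E_bound_nonneg \<open>e > 0\<close> by (auto simp: d_def field_simps)
    obtain N where N: "\<And>n z. n \<ge> N \<Longrightarrow> z \<in> S \<Longrightarrow> dist (s n z) (G z) < d"
      using lim d(1) unfolding uniform_limit_sequentially_iff by metis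
    have "norm (simple_spectral_integral E S (s m) - simple_spectral_integral E S (s n)) < e"
      if "m \<ge> N" "n \<ge> N" for m n
    proof -
      have "cmod (s m z - s n z) \<le> 2 * d" if z: "z \<in> S" for z
        using N[OF \<open>m \<ge> N\<close> z] N[OF \<open>n \<ge> N\<close> z] dist_triangle2[of "s m z" "s n z" "G z"]
        by (simp add: dist_norm)
      then have "norm (simple_spectral_integral E S (\<lambda>z. s m z - s n z)) \<le> 4 * E_bound * (2 * d)"
        using d(1) by (intro simple_integral_norm_le S simple_function_diff s) auto
      then show ?thesis
        using d(2) by (simp add: simple_integral_diff S s)
    qed
    then show "\<exists>N. \<forall>m\<ge>N. \<forall>n\<ge>N.
        norm (simple_spectral_integral E S (s m) - simple_spectral_integral E S (s n)) < e"
      by blast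
  qed
  then show ?thesis
    using s lim by (auto simp: spectral_limit_def Cauchy_convergent_iff convergent_def)
qed

section \<open>The bounded Borel functional calculus over the whole plane\<close>

definition \<Phi> :: "(complex \<Rightarrow> complex) \<Rightarrow> ('a \<Rightarrow>\<^sub>L 'a)" where
  "\<Phi> g = bounded_spectral_integral E UNIV g"

lemma \<Phi>_eqI: "spectral_limit E UNIV g T \<Longrightarrow> \<Phi> g = T"
  unfolding \<Phi>_def by (rule bounded_spectral_integral_eqI) auto

lemma \<Phi>_limit: "bounded_borel g \<Longrightarrow> spectral_limit E UNIV g (\<Phi> g)"
proof -
  assume "bounded_borel g"
  then obtain T where "spectral_limit E UNIV g T"
    using spectral_limit_exists[of UNIV g] by (auto simp: bounded_borel_def measurable_restrict_space1)
  then show ?thesis using \<Phi>_eqI by simp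
qed

lemma \<Phi>_complex_linear: "bounded_borel g \<Longrightarrow> complex_linear (\<Phi> g)"
  using spectral_limit_complex_linear[OF _ \<Phi>_limit] by simp

lemma \<Phi>_add: "bounded_borel g \<Longrightarrow> bounded_borel h \<Longrightarrow> \<Phi> (\<lambda>z. g z + h z) = \<Phi> g + \<Phi> h"
  by (intro \<Phi>_eqI spectral_limit_add \<Phi>_limit) auto

lemma \<Phi>_mult: "bounded_borel g \<Longrightarrow> bounded_borel h \<Longrightarrow> \<Phi> (\<lambda>z. g z * h z) = \<Phi> g o\<^sub>L \<Phi> h"
  by (intro \<Phi>_eqI spectral_limit_mult \<Phi>_limit) (auto simp: bounded_borel_def)

lemma \<Phi>_apply_\<Phi>: "bounded_borel g \<Longrightarrow> bounded_borel h \<Longrightarrow> \<Phi> g (\<Phi> h x) = \<Phi> (\<lambda>z. g z * h z) x"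
  by (simp add: \<Phi>_mult)

lemma \<Phi>_simple:
  assumes "simple_function borel s"
  shows "\<Phi> s = simple_spectral_integral E UNIV s"
  using assms by (intro \<Phi>_eqI spectral_limit_simple) (simp add: simple_function_def space_restrict_space sets_restrict_space)

lemma \<Phi>_indicator: "\<delta> \<in> sets borel \<Longrightarrow> \<Phi> (indicator \<delta>) = E \<delta>"
proof -
  assume \<delta>: "\<delta> \<in> sets borel"
  have "\<Phi> (indicator \<delta>) = simple_spectral_integral E UNIV (indicator \<delta>)"
    using \<delta> by (intro \<Phi>_simple) auto
  also have "\<dots> = (\<Sum>p\<in>range (\<lambda>z. z \<in> \<delta>). (if p then 1 else 0) *\<^sub>C E {z \<in> UNIV. (z \<in> \<delta>) = p})"
    using \<delta> by (intro simple_integral_partition) (auto simp: indicator_def)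
  \<comment> \<open>If \<delta> is empty or the whole plane, only one truth value occurs; the
    missing one contributes \<open>E {}\<close>.\<close>
  also have "\<dots> = (\<Sum>p\<in>(UNIV :: bool set). (if p then 1 else 0) *\<^sub>C E {z \<in> UNIV. (z \<in> \<delta>) = p})"
  proof (rule sum.mono_neutral_left)
    show "\<forall>p\<in>UNIV - range (\<lambda>z. z \<in> \<delta>). (if p then 1 else 0) *\<^sub>C E {z \<in> UNIV. (z \<in> \<delta>) = p} = 0"
    proof
      fix p assume "p \<in> UNIV - range (\<lambda>z. z \<in> \<delta>)"
      then have "{z \<in> UNIV. (z \<in> \<delta>) = p} = {}" by auto
      then show "(if p then 1 else 0) *\<^sub>C E {z \<in> UNIV. (z \<in> \<delta>) = p} = 0"
        by (simp only: E_empty scaleC.zero_right)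
    qed
  qed auto
  also have "\<dots> = E \<delta>" by (simp add: UNIV_bool)
  finally show ?thesis .
qed

lemma \<Phi>_cmult:
  assumes "bounded_borel g"
  shows "\<Phi> (\<lambda>z. c * g z) = c *\<^sub>C \<Phi> g"
proof -
  have "\<Phi> (\<lambda>_. c) = c *\<^sub>C id_blinfun"
    by (subst \<Phi>_simple) (auto simp: simple_spectral_integral_def)
  moreover have "bounded_borel (\<lambda>_. c)" by (auto simp: bounded_borel_def)
  ultimately have "\<Phi> (\<lambda>z. c * g z) = (c *\<^sub>C id_blinfun) o\<^sub>L \<Phi> g"
    using assms by (simp add: \<Phi>_mult)
  then show ?thesis by (intro blinfun_eqI) simp
qed

lemma \<Phi>_norm_le:
  assumes "bounded_borel g" "\<And>z. cmod (g z) \<le> b" "0 \<le> b"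
  shows "norm (\<Phi> g) \<le> 4 * E_bound * b"
  using assms by (intro spectral_limit_norm_le[of UNIV g] \<Phi>_limit) auto

end

section \<open>The spectral integral of the identity function\<close>

lemma shift_eq_Some: "shift B \<mu> f = Some g \<longleftrightarrow> B f = Some (g + \<mu> *\<^sub>C f)"
  by (auto simp: shift_def algebra_simps)

definition resolvent_cutoff :: "complex \<Rightarrow> complex set \<Rightarrow> complex \<Rightarrow> complex" where
  "resolvent_cutoff \<mu> \<delta> z = indicator \<delta> z / (z - \<mu>)"

text \<open>The equation is (z - \<mu>) r(z) = 1 on \<delta> and 0 elsewhere, rearranged so that
  every term is a bounded function and \<Phi> applies to it. Boundedness comes from the distance r
  between \<delta> and \<mu>.\<close>

lemma
  assumes "\<delta> \<in> sets borel" "\<delta> \<inter> ball \<mu> r = {}" "r > 0"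
  shows bounded_borel_resolvent_cutoff: "bounded_borel (resolvent_cutoff \<mu> \<delta>)"
    and mult_resolvent_cutoff:
      "(\<lambda>z. z * resolvent_cutoff \<mu> \<delta> z) = (\<lambda>z. indicator \<delta> z + \<mu> * resolvent_cutoff \<mu> \<delta> z)"
    and bounded_borel_mult_resolvent_cutoff: "bounded_borel (\<lambda>z. z * resolvent_cutoff \<mu> \<delta> z)"
proof -
  have far: "cmod (z - \<mu>) \<ge> r" if "z \<in> \<delta>" for z
    using assms(2) that by (auto simp: dist_norm norm_minus_commute disjoint_iff not_less)
  show b: "bounded_borel (resolvent_cutoff \<mu> \<delta>)"
  proof (rule bounded_borelI)
    show "resolvent_cutoff \<mu> \<delta> \<in> borel_measurable borel"
      unfolding resolvent_cutoff_def using assms(1) by measurable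
    show "cmod (resolvent_cutoff \<mu> \<delta> z) \<le> 1 / r" for z
      using far[of z] assms(3)
      by (auto simp: resolvent_cutoff_def indicator_def norm_divide intro!: divide_left_mono mult_pos_pos)
  qed
  show e: "(\<lambda>z. z * resolvent_cutoff \<mu> \<delta> z) = (\<lambda>z. indicator \<delta> z + \<mu> * resolvent_cutoff \<mu> \<delta> z)"
  proof
    fix z
    have "z \<noteq> \<mu>" if "z \<in> \<delta>" using far[OF that] assms(3) by auto
    then show "z * resolvent_cutoff \<mu> \<delta> z = indicator \<delta> z + \<mu> * resolvent_cutoff \<mu> \<delta> z"
      by (auto simp: resolvent_cutoff_def indicator_def field_simps)
  qed
  show "bounded_borel (\<lambda>z. z * resolvent_cutoff \<mu> \<delta> z)"
    unfolding e by (intro bounded_borel_add bounded_borel_cmult bounded_borel_indicator b assms)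
qed

context spectral_meas
begin

definition integral_id :: "'a \<rightharpoonup> 'a" where
  "integral_id = spectral_integral E UNIV (\<lambda>z. z)"

definition trunc :: "nat \<Rightarrow> complex \<Rightarrow> complex" where "trunc n = truncation UNIV (\<lambda>z. z) n"

lemma trunc_altdef: "trunc n z = z * indicator (cball 0 (real n)) z"
  by (simp add: trunc_def truncation_def indicator_def)

lemma bounded_borel_trunc: "bounded_borel (trunc n)"
proof (rule bounded_borelI)
  show "trunc n \<in> borel_measurable borel"
    unfolding trunc_altdef[abs_def] by (intro borel_measurable_times borel_measurable_indicator) auto
  show "cmod (trunc n z) \<le> real n" for z
    by (simp add: trunc_altdef indicator_def)
qed

lemma integral_id_eq_Some: "integral_id f = Some h \<longleftrightarrow> (\<lambda>n. \<Phi> (trunc n) f) \<longlonglongrightarrow> h"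
proof -
  have "(if convergent X then Some (lim X) else None) = Some h \<longleftrightarrow> X \<longlonglongrightarrow> h" for X :: "nat \<Rightarrow> 'a"
    using convergent_LIMSEQ_iff[of X] convergentI[of X h] limI[of X h] by auto
  then show ?thesis
    by (simp only: integral_id_def spectral_integral_def Let_def \<Phi>_def trunc_def)
qed

lemma E_cball_tendsto: "(\<lambda>n. E (cball 0 (real n)) x) \<longlonglongrightarrow> x"
proof -
  have "(\<Union>n. cball 0 (real n)) = (UNIV :: complex set)"
    using real_arch_simple by (auto simp: subset_iff)
  moreover have "incseq (\<lambda>n. cball (0 :: complex) (real n))"
    unfolding incseq_def by (intro allI impI subset_cball) simp
  ultimately show ?thesis
    using E_incseq[of "\<lambda>n. cball 0 (real n)" x] by (simp add: image_subset_iff)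
qed

text \<open>The complements of the shrinking discs increase to the plane without \<mu>. What the
  cutoff inverses of A - \<mu>I miss in the limit is therefore exactly the part carried by the point
  \<mu>.\<close>

lemma E_annulus_tendsto: "(\<lambda>n. E (- ball \<mu> (1 / real (Suc n))) x) \<longlonglongrightarrow> x - E {\<mu>} x"
proof -
  have "(\<Union>n. - ball \<mu> (1 / real (Suc n))) = - {\<mu>}"
  proof (intro equalityI subsetI)
    fix z assume "z \<in> - {\<mu>}"
    then obtain n where "1 / real (Suc n) < dist \<mu> z"
      using nat_approx_posE[of "dist \<mu> z"] by auto
    then have "z \<in> - ball \<mu> (1 / real (Suc n))" by simp
    then show "z \<in> (\<Union>n. - ball \<mu> (1 / real (Suc n)))" by blast
  qed auto
  moreover have "incseq (\<lambda>n. - ball \<mu> (1 / real (Suc n)))"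
    unfolding incseq_def Compl_subset_Compl_iff
    by (intro allI impI subset_ball) (simp add: field_simps)
  ultimately show ?thesis
    using E_incseq[of "\<lambda>n. - ball \<mu> (1 / real (Suc n))" x] E_Compl[of "{\<mu>}"]
    by (simp add: image_subset_iff minus_blinfun.rep_eq)
qed

text \<open>Truncating z in front of g amounts to applying the projection of a disc to the fixed
  vector on the right, and these projections converge strongly to the identity. This is the basic
  way to produce elements of the domain.\<close>

lemma integral_id_\<Phi>:
  assumes "bounded_borel g" "bounded_borel (\<lambda>z. z * g z)"
  shows "integral_id (\<Phi> g f) = Some (\<Phi> (\<lambda>z. z * g z) f)"
proof -
  have "\<Phi> (trunc n) (\<Phi> g f) = E (cball 0 (real n)) (\<Phi> (\<lambda>z. z * g z) f)" for n
  proof -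
    have "\<Phi> (trunc n) (\<Phi> g f) = \<Phi> (\<lambda>z. indicator (cball 0 (real n)) z * (z * g z)) f"
      by (simp add: \<Phi>_apply_\<Phi> bounded_borel_trunc assms trunc_altdef mult_ac)
    then show ?thesis
      by (simp add: \<Phi>_mult bounded_borel_indicator assms \<Phi>_indicator)
  qed
  then show ?thesis by (simp add: integral_id_eq_Some E_cball_tendsto)
qed

lemma integral_id_\<Phi>_commute:
  assumes "integral_id f = Some h" "bounded_borel g"
  shows "integral_id (\<Phi> g f) = Some (\<Phi> g h)"
proof -
  have "\<Phi> (trunc n) (\<Phi> g f) = \<Phi> g (\<Phi> (trunc n) f)" for n
    by (simp add: \<Phi>_apply_\<Phi> bounded_borel_trunc assms mult.commute)
  moreover have "(\<lambda>n. \<Phi> g (\<Phi> (trunc n) f)) \<longlonglongrightarrow> \<Phi> g h"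
    using assms by (intro tendsto_intros) (simp add: integral_id_eq_Some)
  ultimately show ?thesis by (simp add: integral_id_eq_Some)
qed

section \<open>The integral of the identity function as a closed, densely defined operator\<close>

lemma linear_operator_integral_id: "linear_operator integral_id"
  unfolding linear_operator_def
proof (intro conjI allI impI)
  show "integral_id 0 = Some 0" by (simp add: integral_id_eq_Some)
  show "integral_id (f + g) = Some (u + v)" if "integral_id f = Some u" "integral_id g = Some v" for f g u v
    using that by (simp add: integral_id_eq_Some blinfun.add_right tendsto_add)
  show "integral_id (c *\<^sub>C f) = Some (c *\<^sub>C u)" if "integral_id f = Some u" for c f u
  proof -
    have "\<Phi> (trunc n) (c *\<^sub>C f) = c *\<^sub>C \<Phi> (trunc n) f" for n
      using \<Phi>_complex_linear[OF bounded_borel_trunc] by (simp add: complex_linear_def)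
    then show ?thesis
      using that by (auto simp: integral_id_eq_Some intro: scaleC.tendsto)
  qed
qed

text \<open>Evaluates A on the disc part of f in two ways, by commuting A with the projection and by
  integrating z over the disc. Both sides involve bounded operators only, so the identity survives
  limits in f and h.\<close>

lemma E_cball_integral_id:
  assumes "integral_id f = Some h"
  shows "E (cball 0 (real n)) h = \<Phi> (trunc n) f"
proof -
  let ?g = "indicator (cball 0 (real n)) :: complex \<Rightarrow> complex"
  have b: "bounded_borel ?g" "bounded_borel (\<lambda>z. z * ?g z)"
    using bounded_borel_trunc[of n] by (auto simp: bounded_borel_indicator trunc_altdef[abs_def])
  have "Some (\<Phi> ?g h) = Some (\<Phi> (\<lambda>z. z * ?g z) f)"
    using integral_id_\<Phi>[OF b] integral_id_\<Phi>_commute[OF assms b(1)] by metis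
  then show ?thesis by (simp add: \<Phi>_indicator trunc_altdef[abs_def])
qed

text \<open>With the disc fixed, the bounded identity of \<open>E_cball_integral_id\<close> passes
  to the limit along the graph; letting the disc grow afterwards recovers membership in the domain
  together with the value.\<close>

lemma closed_operator_integral_id: "closed_operator integral_id"
  unfolding closed_operator_def closed_sequential_limits
proof (intro allI impI, elim conjE)
  fix p :: "nat \<Rightarrow> 'a \<times> 'a" and l
  assume p: "\<forall>n. p n \<in> Map.graph integral_id" and l: "p \<longlonglongrightarrow> l"
  obtain f h where fh: "l = (f, h)" by (cases l)
  have lim: "(\<lambda>k. fst (p k)) \<longlonglongrightarrow> f" "(\<lambda>k. snd (p k)) \<longlonglongrightarrow> h"
    using tendsto_fst[OF l] tendsto_snd[OF l] by (auto simp: fh)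
  have "integral_id (fst (p k)) = Some (snd (p k))" for k
    using p by (metis in_graphD prod.collapse)
  then have eq: "E (cball 0 (real n)) (snd (p k)) = \<Phi> (trunc n) (fst (p k))" for n k
    by (rule E_cball_integral_id)
  have "E (cball 0 (real n)) h = \<Phi> (trunc n) f" for n
  proof (rule LIMSEQ_unique)
    show "(\<lambda>k. E (cball 0 (real n)) (snd (p k))) \<longlonglongrightarrow> E (cball 0 (real n)) h"
      by (intro tendsto_intros lim)
    show "(\<lambda>k. E (cball 0 (real n)) (snd (p k))) \<longlonglongrightarrow> \<Phi> (trunc n) f"
      unfolding eq by (intro tendsto_intros lim)
  qed
  with E_cball_tendsto[of h] have "integral_id f = Some h" by (simp add: integral_id_eq_Some)
  then show "l \<in> Map.graph integral_id" by (simp add: fh in_graphI)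
qed

lemma densely_defined_integral_id: "densely_defined integral_id"
  unfolding densely_defined_def
proof (intro equalityI subset_UNIV subsetI)
  fix x :: 'a
  let ?g = "\<lambda>n. indicator (cball 0 (real n)) :: complex \<Rightarrow> complex"
  have "integral_id (\<Phi> (?g n) x) = Some (\<Phi> (\<lambda>z. z * ?g n z) x)" for n
    using bounded_borel_trunc[of n]
    by (intro integral_id_\<Phi>) (auto simp: bounded_borel_indicator trunc_altdef[abs_def])
  then have "E (cball 0 (real n)) x \<in> dom integral_id" for n
    by (auto simp: \<Phi>_indicator)
  then show "x \<in> closure (dom integral_id)"
    using E_cball_tendsto[of x] unfolding closure_sequential
    by (intro exI[of _ "\<lambda>n. E (cball 0 (real n)) x"]) simp
qed

lemma resolution_of_identity_integral_id: "resolution_of_identity integral_id E"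
  by (simp add: resolution_of_identity_def integral_id_def spectral_measure)

lemma scalar_type_integral_id: "scalar_type_spectral_operator integral_id"
  unfolding scalar_type_spectral_operator_def
  using linear_operator_integral_id closed_operator_integral_id densely_defined_integral_id resolution_of_identity_integral_id by blast

text \<open>Off any neighbourhood of \<open>\<mu>\<close> the operator \<open>A - \<mu>I\<close> has the bounded inverse
  \<open>\<integral> 1 / (z - \<mu>) dE(z)\<close>.\<close>

lemma
  assumes "\<delta> \<in> sets borel" "\<delta> \<inter> ball \<mu> r = {}" "r > 0"
  shows shift_resolvent_cutoff: "shift integral_id \<mu> (\<Phi> (resolvent_cutoff \<mu> \<delta>) x) = Some (E \<delta> x)"
    and resolvent_cutoff_shift: "shift integral_id \<mu> f = Some g \<Longrightarrow> \<Phi> (resolvent_cutoff \<mu> \<delta>) g = E \<delta> f"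
proof -
  let ?r = "resolvent_cutoff \<mu> \<delta>"
  note b = bounded_borel_resolvent_cutoff[OF assms] bounded_borel_mult_resolvent_cutoff[OF assms]
  have r: "\<Phi> (\<lambda>z. z * ?r z) = E \<delta> + \<mu> *\<^sub>C \<Phi> ?r"
    unfolding mult_resolvent_cutoff[OF assms]
    using assms b by (simp add: \<Phi>_add \<Phi>_cmult bounded_borel_cmult bounded_borel_indicator \<Phi>_indicator)
  show "shift integral_id \<mu> (\<Phi> ?r x) = Some (E \<delta> x)"
    using integral_id_\<Phi>[OF b] by (simp add: shift_eq_Some r plus_blinfun.rep_eq)
  show "\<Phi> ?r g = E \<delta> f" if "shift integral_id \<mu> f = Some g"
  proof -
    have "integral_id f = Some (g + \<mu> *\<^sub>C f)"
      using that by (simp add: shift_eq_Some)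
    then have "\<Phi> ?r (g + \<mu> *\<^sub>C f) = \<Phi> (\<lambda>z. z * ?r z) f"
      using integral_id_\<Phi>[OF b, of f] integral_id_\<Phi>_commute[OF _ b(1)] by fastforce
    moreover have "\<Phi> ?r (\<mu> *\<^sub>C f) = \<mu> *\<^sub>C \<Phi> ?r f"
      using \<Phi>_complex_linear[OF b(1)] by (simp add: complex_linear_def)
    ultimately show ?thesis
      by (simp add: r blinfun.add_right plus_blinfun.rep_eq)
  qed
qed

text \<open>On the set {\<mu>} the function z is the constant \<mu>, so every vector in the range of
  the projection is annihilated by A - \<mu>I.\<close>

lemma shift_E_singleton: "shift integral_id \<mu> (E {\<mu>} x) = Some 0"
proof -
  have eq: "(\<lambda>z. z * indicator {\<mu>} z) = (\<lambda>z. \<mu> * indicator {\<mu>} z :: complex)"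
    by (auto simp: indicator_def)
  have "integral_id (\<Phi> (indicator {\<mu>}) x) = Some (\<Phi> (\<lambda>z. z * indicator {\<mu>} z) x)"
    by (rule integral_id_\<Phi>) (simp_all add: eq bounded_borel_cmult bounded_borel_indicator)
  then show ?thesis
    unfolding eq by (simp add: shift_eq_Some \<Phi>_cmult bounded_borel_indicator \<Phi>_indicator)
qed

lemma resolvent_cutoff_shift_annulus:
  assumes "shift integral_id \<mu> f = Some g"
  shows "\<Phi> (resolvent_cutoff \<mu> (- ball \<mu> (1 / real (Suc n)))) g = E (- ball \<mu> (1 / real (Suc n))) f"
  using assms by (intro resolvent_cutoff_shift[where r = "1 / real (Suc n)"]) auto

text \<open>The cutoff inverses map (A - \<mu>I) f = 0 to the parts of f away from \<mu>; these all
  vanish, and their limit is f minus its part at \<mu>.\<close>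

lemma kernel_shift_integral_id: "kernel (shift integral_id \<mu>) = {f. E {\<mu>} f = f}"
proof (intro equalityI subsetI)
  fix f assume "f \<in> kernel (shift integral_id \<mu>)"
  then have "shift integral_id \<mu> f = Some 0" by (simp add: kernel_def)
  from resolvent_cutoff_shift_annulus[OF this] have "E (- ball \<mu> (1 / real (Suc n))) f = 0" for n
    by simp
  with E_annulus_tendsto[of \<mu> f] show "f \<in> {f. E {\<mu>} f = f}"
    by (simp add: LIMSEQ_const_iff)
next
  fix f assume "f \<in> {f. E {\<mu>} f = f}"
  then show "f \<in> kernel (shift integral_id \<mu>)"
    using shift_E_singleton[of \<mu> f] by (simp add: kernel_def)
qed

text \<open>The projection at \<mu> commutes with A, which acts as \<mu> on its range, so it kills
  every (A - \<mu>I) f. Conversely the parts of f away from \<mu> lie in the range by the cutoff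
  inverses, and they tend to f when f has no part at \<mu>.\<close>

lemma closure_ran_shift_integral_id: "closure (ran (shift integral_id \<mu>)) = {f. E {\<mu>} f = 0}"
proof (intro equalityI subsetI)
  fix f assume "f \<in> closure (ran (shift integral_id \<mu>))"
  moreover have "ran (shift integral_id \<mu>) \<subseteq> {f. E {\<mu>} f = 0}"
  proof
    fix g assume "g \<in> ran (shift integral_id \<mu>)"
    then obtain f where "integral_id f = Some (g + \<mu> *\<^sub>C f)" by (auto simp: ran_def shift_eq_Some)
    then have "integral_id (E {\<mu>} f) = Some (E {\<mu>} (g + \<mu> *\<^sub>C f))"
      using integral_id_\<Phi>_commute[of f _ "indicator {\<mu>}"] by (simp add: bounded_borel_indicator \<Phi>_indicator)
    moreover have "integral_id (E {\<mu>} f) = Some (\<mu> *\<^sub>C E {\<mu>} f)"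
      using shift_E_singleton[of \<mu> f] by (simp add: shift_eq_Some)
    moreover have "E {\<mu>} (\<mu> *\<^sub>C f) = \<mu> *\<^sub>C E {\<mu>} f"
      using complex_linear_E[of "{\<mu>}"] by (simp add: complex_linear_def)
    ultimately show "g \<in> {f. E {\<mu>} f = 0}" by (simp add: blinfun.add_right)
  qed
  moreover have "closed {f. E {\<mu>} f = 0}"
    by (intro closed_Collect_eq continuous_intros)
  ultimately show "f \<in> {f. E {\<mu>} f = 0}"
    using closure_minimal by blast
next
  fix f assume "f \<in> {f. E {\<mu>} f = 0}"
  then have "(\<lambda>n. E (- ball \<mu> (1 / real (Suc n))) f) \<longlonglongrightarrow> f"
    using E_annulus_tendsto[of \<mu> f] by simp
  moreover have "E (- ball \<mu> (1 / real (Suc n))) f \<in> ran (shift integral_id \<mu>)" for n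
    using shift_resolvent_cutoff[of "- ball \<mu> (1 / real (Suc n))" \<mu> "1 / real (Suc n)" f]
    by (auto intro: ranI)
  ultimately show "f \<in> closure (ran (shift integral_id \<mu>))"
    unfolding closure_sequential
    by (intro exI[of _ "\<lambda>n. E (- ball \<mu> (1 / real (Suc n))) f"]) blast
qed

lemma inj_shift_A_iff: "inj_on (shift integral_id \<mu>) (dom integral_id) \<longleftrightarrow> E {\<mu>} = 0"
proof
  assume inj: "inj_on (shift integral_id \<mu>) (dom integral_id)"
  have "E {\<mu>} x = 0" for x
  proof (rule inj_onD[OF inj])
    have "shift integral_id \<mu> 0 = Some 0"
      using linear_operator_integral_id by (simp add: shift_eq_Some linear_operator_def scaleC.zero_right)
    with shift_E_singleton[of \<mu> x]
    show "shift integral_id \<mu> (E {\<mu>} x) = shift integral_id \<mu> 0" "0 \<in> dom integral_id" "E {\<mu>} x \<in> dom integral_id"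
      by (simp, auto simp: shift_eq_Some)
  qed
  then show "E {\<mu>} = 0" by (intro blinfun_eqI) simp
next
  assume 0: "E {\<mu>} = 0"
  show "inj_on (shift integral_id \<mu>) (dom integral_id)"
  proof (rule inj_onI)
    fix f g assume "f \<in> dom integral_id" "g \<in> dom integral_id" "shift integral_id \<mu> f = shift integral_id \<mu> g"
    then obtain u where u: "shift integral_id \<mu> f = Some u" "shift integral_id \<mu> g = Some u"
      by (auto simp: shift_def)
    have "(\<lambda>n. E (- ball \<mu> (1 / real (Suc n))) f) = (\<lambda>n. E (- ball \<mu> (1 / real (Suc n))) g)"
      using u[THEN resolvent_cutoff_shift_annulus] by metis
    with E_annulus_tendsto[of \<mu> f] E_annulus_tendsto[of \<mu> g] show "f = g"
      by (simp add: 0 LIMSEQ_unique)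
  qed
qed

section \<open>Point spectrum, resolvent set and continuous spectrum in terms of the measure\<close>

lemma point_spectrum_integral_id: "point_spectrum integral_id = {\<mu>. E {\<mu>} \<noteq> 0}"
  by (simp add: point_spectrum_def inj_shift_A_iff)

text \<open>On the range of the projection of a disc, A - \<mu>I is the integral of a function
  bounded by the radius. Nonzero vectors there are approximate eigenvectors, which rule out a
  bounded inverse and also bound the spectrum of a bounded operator.\<close>

lemma shift_E_ball:
  assumes "r > 0"
  shows "\<exists>y. shift integral_id \<mu> (E (ball \<mu> r) x) = Some y \<and> norm y \<le> 4 * E_bound * r * norm (E (ball \<mu> r) x)"
proof -
  let ?c = "indicator (ball \<mu> r) :: complex \<Rightarrow> complex"
  let ?h = "\<lambda>z. (z - \<mu>) * ?c z"
  define v where "v = E (ball \<mu> r) x"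
  have v: "E (ball \<mu> r) v = v"
    by (simp add: v_def E_apply_E)
  have h: "cmod (?h z) \<le> r" for z
    using assms by (auto simp: indicator_def dist_norm norm_minus_commute)
  have bc: "bounded_borel ?c" by (simp add: bounded_borel_indicator)
  have bh: "bounded_borel ?h"
    by (rule bounded_borelI[OF _ h])
      (intro borel_measurable_times borel_measurable_indicator borel_measurable_diff; simp)
  have "bounded_borel (\<lambda>z. ?h z + \<mu> * ?c z)"
    by (intro bounded_borel_add bounded_borel_cmult bc bh)
  moreover have eq: "(\<lambda>z. z * ?c z) = (\<lambda>z. ?h z + \<mu> * ?c z)"
    by (simp add: fun_eq_iff algebra_simps)
  ultimately have "integral_id (\<Phi> ?c v) = Some (\<Phi> (\<lambda>z. z * ?c z) v)"
    by (intro integral_id_\<Phi> bc) (simp only: eq)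
  then have "integral_id v = Some (\<Phi> ?h v + \<mu> *\<^sub>C v)"
    unfolding eq
    by (simp add: \<Phi>_add \<Phi>_cmult bh bc bounded_borel_cmult \<Phi>_indicator v plus_blinfun.rep_eq)
  then have "shift integral_id \<mu> v = Some (\<Phi> ?h v)"
    by (simp add: shift_eq_Some)
  moreover have "norm (\<Phi> ?h v) \<le> 4 * E_bound * r * norm v"
    using norm_blinfun[of "\<Phi> ?h" v] \<Phi>_norm_le[OF bh h] assms
    by (meson less_imp_le mult_right_mono norm_ge_zero order_trans)
  ultimately show ?thesis unfolding v_def by blast
qed

lemma small_radius: "b > 0 \<Longrightarrow> \<exists>r>0. 4 * E_bound * r < b"
proof -
  assume "b > 0"
  then have "b / (4 * E_bound + 1) > 0" "4 * E_bound * (b / (4 * E_bound + 1)) < b"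
    using E_bound_nonneg by (auto simp: field_simps)
  then show ?thesis by blast
qed

text \<open>A bounded inverse R gives norm v \<le> norm R times norm ((A - \<mu>I) v), which fails
  for approximate eigenvectors from a small disc unless that disc is null. If it is null, its
  complement has projection I, and the cutoff inverse on the complement is a true inverse.\<close>

lemma resolvent_set_integral_id: "resolvent_set integral_id = {\<mu>. \<exists>r>0. E (ball \<mu> r) = 0}"
proof (intro equalityI subsetI)
  fix \<mu> assume "\<mu> \<in> resolvent_set integral_id"
  then obtain R where R: "\<And>f g. shift integral_id \<mu> f = Some g \<longleftrightarrow> blinfun_apply R g = f"
    by (auto simp: resolvent_set_def)
  \<comment> \<open>The summand 1 covers R = 0 and makes the factor
    \<open>norm R / (norm R + 1)\<close> strictly less than 1.\<close>
  obtain r where r: "r > 0" "4 * E_bound * r < 1 / (norm R + 1)"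
    using small_radius[of "1 / (norm R + 1)"] by (auto simp: add_nonneg_pos)
  have "E (ball \<mu> r) x = 0" for x
  proof (rule ccontr)
    assume v: "E (ball \<mu> r) x \<noteq> 0"
    define v where "v = E (ball \<mu> r) x"
    obtain y where y: "shift integral_id \<mu> v = Some y" "norm y \<le> 4 * E_bound * r * norm v"
      using shift_E_ball[OF r(1), of \<mu> x] by (auto simp: v_def)
    have "norm v \<le> norm R * norm y"
      using y(1) R norm_blinfun[of R y] by auto
    also have "\<dots> \<le> norm R * (4 * E_bound * r * norm v)"
      by (intro mult_left_mono y) auto
    also have "\<dots> \<le> norm R * (1 / (norm R + 1) * norm v)"
      using r by (intro mult_left_mono mult_right_mono) auto
    also have "\<dots> = norm R / (norm R + 1) * norm v" by simp
    also have "\<dots> < 1 * norm v"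
      using v by (intro mult_strict_right_mono) (auto simp: v_def divide_less_eq_1 add_nonneg_pos)
    finally show False by simp
  qed
  then show "\<mu> \<in> {\<mu>. \<exists>r>0. E (ball \<mu> r) = 0}"
    using r(1) by (auto intro!: exI[of _ r] blinfun_eqI)
next
  fix \<mu> assume "\<mu> \<in> {\<mu>. \<exists>r>0. E (ball \<mu> r) = 0}"
  then obtain r where r: "r > 0" "E (ball \<mu> r) = 0" by auto
  define \<delta> where "\<delta> = - ball \<mu> r"
  have \<delta>: "\<delta> \<in> sets borel" "\<delta> \<inter> ball \<mu> r = {}" "E \<delta> = id_blinfun"
    using r E_Compl[of "ball \<mu> r"] by (auto simp: \<delta>_def)
  have "shift integral_id \<mu> f = Some g \<longleftrightarrow> \<Phi> (resolvent_cutoff \<mu> \<delta>) g = f" for f g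
    using shift_resolvent_cutoff[OF \<delta>(1,2) r(1), of g] resolvent_cutoff_shift[OF \<delta>(1,2) r(1), of f g]
    by (auto simp: \<delta>(3))
  then show "\<mu> \<in> resolvent_set integral_id"
    unfolding resolvent_set_def
    using \<Phi>_complex_linear[OF bounded_borel_resolvent_cutoff[OF \<delta>(1,2) r(1)]] by blast
qed

text \<open>The bounded operators \<open>\<integral>\<^bsub>|z - \<mu>| \<ge> 1/(n+1)\<^esub> 1 / (z - \<mu>) dE(z)\<close> converge pointwise to the
  inverse of \<open>A - \<mu>I\<close>, so the uniform boundedness principle replaces the closed graph theorem.\<close>

lemma surj_shift_imp_resolvent:
  assumes 0: "E {\<mu>} = 0" and ran: "ran (shift integral_id \<mu>) = UNIV"
  shows "\<mu> \<in> resolvent_set integral_id"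
proof -
  define T where "T n = \<Phi> (resolvent_cutoff \<mu> (- ball \<mu> (1 / real (Suc n))))" for n
  have lim: "(\<lambda>n. T n g) \<longlonglongrightarrow> f" if "shift integral_id \<mu> f = Some g" for f g
    using E_annulus_tendsto[of \<mu> f] resolvent_cutoff_shift_annulus[OF that] by (simp add: 0 T_def)
  have ex: "\<exists>f. shift integral_id \<mu> f = Some g" for g
    using ran by (auto simp: ran_def set_eq_iff)
  have conv: "convergent (\<lambda>n. T n g)" for g
    using ex lim convergentI by blast
  obtain K where K: "\<And>n. norm (T n) \<le> K"
    using uniform_boundedness_convergent[of T] conv by blast
  define R where "R g = lim (\<lambda>n. T n g)" for g
  have R: "(\<lambda>n. T n g) \<longlonglongrightarrow> R g" for g
    using conv by (simp add: R_def convergent_LIMSEQ_iff)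
  have cT: "T n (c *\<^sub>C g) = c *\<^sub>C T n g" for n c g
    using \<Phi>_complex_linear[OF bounded_borel_resolvent_cutoff[of "- ball \<mu> (1 / real (Suc n))" \<mu> "1 / real (Suc n)"]]
    by (auto simp: T_def complex_linear_def)
  have cR: "R (c *\<^sub>C g) = c *\<^sub>C R g" for c g
    using scaleC.tendsto[OF tendsto_const[of c] R[of g]] R[of "c *\<^sub>C g"]
    by (simp add: cT LIMSEQ_unique)
  have "bounded_linear R"
  proof (rule bounded_linear_intro)
    show "R (x + y) = R x + R y" for x y
      using tendsto_add[OF R[of x] R[of y]] R[of "x + y"]
      by (simp add: blinfun.add_right LIMSEQ_unique)
    show "R (r *\<^sub>R x) = r *\<^sub>R R x" for r x
      using cR[of "of_real r" x] by (simp add: scaleC_of_real)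
    show "norm (R x) \<le> norm x * K" for x
    proof (rule tendsto_upperbound[OF tendsto_norm[OF R]])
      show "\<forall>\<^sub>F n in sequentially. norm (T n x) \<le> norm x * K"
      proof (intro always_eventually allI)
        fix n
        show "norm (T n x) \<le> norm x * K"
          using norm_blinfun[of "T n" x] mult_right_mono[OF K[of n] norm_ge_zero[of x]]
          by (simp add: mult.commute)
      qed
    qed simp
  qed
  then have app: "blinfun_apply (Blinfun R) = R" by (rule bounded_linear_Blinfun_apply)
  \<comment> \<open>From left to right, \<open>T n g\<close> tends both to f and to R g. From right
    to left, surjectivity supplies some preimage of g, which the first direction identifies with R
    g.\<close>
  have "shift integral_id \<mu> f = Some g \<longleftrightarrow> R g = f" for f g
    using lim R ex LIMSEQ_unique by metis
  then show ?thesis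
    unfolding resolvent_set_def using cR
    by (auto intro!: exI[of _ "Blinfun R"] simp: complex_linear_def app)
qed

text \<open>Once the point \<mu> is null, A - \<mu>I is injective and its range is dense. Only
  surjectivity remains to be decided, and here it is equivalent to \<mu> being in the resolvent
  set.\<close>

lemma continuous_spectrum_integral_id:
  "continuous_spectrum integral_id = {\<mu>. E {\<mu>} = 0 \<and> (\<forall>r>0. E (ball \<mu> r) \<noteq> 0)}"
proof -
  have "ran (shift integral_id \<mu>) = UNIV" if "\<mu> \<in> resolvent_set integral_id" for \<mu>
    using that by (auto simp: resolvent_set_def ran_def)
  then have "ran (shift integral_id \<mu>) = UNIV \<longleftrightarrow> (\<exists>r>0. E (ball \<mu> r) = 0)" if "E {\<mu>} = 0" for \<mu>
    using surj_shift_imp_resolvent[OF that] resolvent_set_integral_id by blast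
  then show ?thesis
    by (auto simp: continuous_spectrum_def inj_shift_A_iff closure_ran_shift_integral_id)
qed

lemma spectrum_integral_id: "spectrum integral_id = {\<mu>. \<forall>r>0. E (ball \<mu> r) \<noteq> 0}"
  by (auto simp: spectrum_def resolvent_set_integral_id)

lemma closed_spectrum_integral_id: "closed (spectrum integral_id)"
  unfolding spectrum_def closed_def double_complement
proof (subst open_subopen, intro ballI)
  fix \<mu> assume "\<mu> \<in> resolvent_set integral_id"
  then obtain r where r: "r > 0" "E (ball \<mu> r) = 0" by (auto simp: resolvent_set_integral_id)
  have "\<nu> \<in> resolvent_set integral_id" if \<nu>: "\<nu> \<in> ball \<mu> r" for \<nu>
  proof -
    obtain e where "e > 0" "ball \<nu> e \<subseteq> ball \<mu> r"
      using openE[OF open_ball \<nu>] by blast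
    then show ?thesis
      using E_null_mono[OF r(2), of "ball \<nu> e"] by (auto simp: resolvent_set_integral_id)
  qed
  then show "\<exists>T. open T \<and> \<mu> \<in> T \<and> T \<subseteq> resolvent_set integral_id"
    using r(1) by (intro exI[of _ "ball \<mu> r"]) auto
qed

text \<open>The resolvent set is covered by null discs, in general uncountably many; Lindelof
  reduces the cover to a countable one, to which countable additivity applies.\<close>

lemma E_spectrum: "E (spectrum integral_id) = id_blinfun"
proof -
  let ?\<B> = "{ball \<mu> r | \<mu> r. E (ball \<mu> r) = 0}"
  obtain \<B> where B: "\<B> \<subseteq> ?\<B>" "countable \<B>" "\<Union>\<B> = \<Union>?\<B>"
    using Lindelof[of ?\<B>] by auto
  have "- spectrum integral_id \<subseteq> \<Union>?\<B>"
    by (force simp: spectrum_integral_id)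
  then have "- spectrum integral_id \<subseteq> \<Union>\<B>" using B(3) by simp
  moreover have "E (\<Union>\<B>) = 0"
    using B by (intro E_countable_null) auto
  moreover have "open (\<Union>\<B>)" using B(1) by (intro open_Union) auto
  ultimately have "E (- spectrum integral_id) = 0"
    using E_null_mono[of "\<Union>\<B>" "- spectrum integral_id"] closed_spectrum_integral_id by auto
  then show ?thesis
    using E_Compl[of "spectrum integral_id"] closed_spectrum_integral_id by auto
qed

text \<open>If the measure lives on a disc, truncations at larger radii no longer change anything,
  so the defining sequence is eventually constant on every vector.\<close>

lemma bounded_operator_integral_id:
  assumes "E (cball 0 b) = id_blinfun"
  shows "bounded_operator integral_id"
proof -
  obtain N :: nat where N: "b \<le> real N" using real_arch_simple by blast
  have eq: "\<Phi> (trunc n) f = \<Phi> (trunc N) f" if "n \<ge> N" for n f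
  proof -
    have "cball 0 b \<subseteq> (cball 0 (real N) :: complex set)" using N by auto
    then have "E (cball 0 (real N)) f = f"
      using E_apply_E[of "cball 0 (real N)" "cball 0 b" f] by (simp add: assms Int_absorb1)
    then have "\<Phi> (trunc n) f = \<Phi> (\<lambda>z. trunc n z * indicator (cball 0 (real N)) z) f"
      by (simp add: \<Phi>_mult bounded_borel_trunc bounded_borel_indicator \<Phi>_indicator)
    also have "(\<lambda>z. trunc n z * indicator (cball 0 (real N)) z) = trunc N"
      using that by (auto simp: trunc_altdef indicator_def fun_eq_iff)
    finally show ?thesis .
  qed
  have "integral_id f = Some (\<Phi> (trunc N) f)" for f
    unfolding integral_id_eq_Some
    by (rule tendsto_eventually[OF eventually_sequentiallyI]) (rule eq)
  then show ?thesis
    unfolding bounded_operator_def using \<Phi>_complex_linear[OF bounded_borel_trunc] by blast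
qed

text \<open>An approximate eigenvector v for \<mu> makes T v nearly \<mu> v, which is impossible
  when the modulus of \<mu> exceeds the norm of T.\<close>

lemma bounded_spectrum_integral_id:
  assumes "bounded_operator integral_id"
  shows "bounded (spectrum integral_id)"
proof -
  obtain T where T: "\<And>f. integral_id f = Some (blinfun_apply T f)"
    using assms by (auto simp: bounded_operator_def)
  have "cmod \<mu> \<le> norm T" if "\<mu> \<in> spectrum integral_id" for \<mu>
  proof (rule ccontr)
    assume "\<not> cmod \<mu> \<le> norm T"
    then obtain r where r: "r > 0" "4 * E_bound * r < cmod \<mu> - norm T"
      using small_radius[of "cmod \<mu> - norm T"] by auto
    have "E (ball \<mu> r) x = 0" for x
    proof (rule ccontr)
      assume v: "E (ball \<mu> r) x \<noteq> 0"
      define v where "v = E (ball \<mu> r) x"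
      obtain y where y: "shift integral_id \<mu> v = Some y" "norm y \<le> 4 * E_bound * r * norm v"
        using shift_E_ball[OF r(1), of \<mu> x] by (auto simp: v_def)
      have "\<mu> *\<^sub>C v = T v - y"
        using y(1) by (simp add: shift_eq_Some T)
      then have "cmod \<mu> * norm v = norm (T v - y)"
        by (metis norm_scaleC)
      also have "\<dots> \<le> norm T * norm v + 4 * E_bound * r * norm v"
        using norm_triangle_ineq4[of "T v" y] norm_blinfun[of T v] y(2) by linarith
      also have "\<dots> < norm T * norm v + (cmod \<mu> - norm T) * norm v"
        using r(2) v by (simp add: v_def)
      finally show False by (simp add: algebra_simps)
    qed
    then have "E (ball \<mu> r) = 0" by (intro blinfun_eqI) simp
    then show False
      using that r(1) by (auto simp: spectrum_integral_id)
  qed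
  then show ?thesis by (auto simp: bounded_iff)
qed

end

text \<open>A projection is determined by its range and its kernel. At a point \<mu> these are the
  kernel of B - \<mu>I and the closure of its range, which do not mention the measure.\<close>

lemma resolution_of_identity_singleton_unique:
  assumes "resolution_of_identity B E" "resolution_of_identity B E'"
  shows "E {\<mu>} = E' {\<mu>}"
proof -
  interpret E: spectral_meas E using assms by unfold_locales (simp add: resolution_of_identity_def)
  interpret E': spectral_meas E' using assms by unfold_locales (simp add: resolution_of_identity_def)
  have B: "E.integral_id = B" "E'.integral_id = B"
    using assms by (simp_all add: resolution_of_identity_def E.integral_id_def E'.integral_id_def)
  have fixed: "E {\<mu>} f = f \<longleftrightarrow> E' {\<mu>} f = f" for f
    using E.kernel_shift_integral_id[of \<mu>] E'.kernel_shift_integral_id[of \<mu>] by (auto simp: B)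
  have zero: "E {\<mu>} f = 0 \<longleftrightarrow> E' {\<mu>} f = 0" for f
    using E.closure_ran_shift_integral_id[of \<mu>] E'.closure_ran_shift_integral_id[of \<mu>] by (auto simp: B)
  have idem: "E {\<mu>} (E {\<mu>} x) = E {\<mu>} x" for x
    by (simp add: E.E_apply_E)
  show ?thesis
  proof (rule blinfun_eqI)
    fix x
    have "E' {\<mu>} (x - E {\<mu>} x) = 0"
      unfolding zero[symmetric] by (simp add: blinfun.diff_right idem)
    moreover have "E' {\<mu>} (E {\<mu>} x) = E {\<mu>} x"
      unfolding fixed[symmetric] by (rule idem)
    ultimately show "E {\<mu>} x = E' {\<mu>} x"
      by (simp add: blinfun.diff_right)
  qed
qed

section \<open>Change of variables\<close>

text \<open>Preimages are taken inside S, as F is meaningful only there; when E(S) = I, the image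
  measure still has total value I.\<close>

definition image_measure ::
    "(complex set \<Rightarrow> ('a::complex_banach \<Rightarrow>\<^sub>L 'a)) \<Rightarrow> complex set \<Rightarrow> (complex \<Rightarrow> complex) \<Rightarrow> complex set \<Rightarrow> ('a \<Rightarrow>\<^sub>L 'a)"
  where "image_measure E S F \<delta> = E {z \<in> S. F z \<in> \<delta>}"

locale spectral_map = spectral_meas E for E :: "complex set \<Rightarrow> ('a::complex_banach \<Rightarrow>\<^sub>L 'a)" +
  fixes S :: "complex set" and F :: "complex \<Rightarrow> complex"
  assumes S [measurable]: "S \<in> sets borel" and E_S: "E S = id_blinfun"
    and F [measurable]: "F \<in> borel_measurable (restrict_space borel S)"
begin

abbreviation EF :: "complex set \<Rightarrow> ('a \<Rightarrow>\<^sub>L 'a)" where "EF \<equiv> image_measure E S F"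

lemma sets_preimage: "\<delta> \<in> sets borel \<Longrightarrow> {z \<in> S. F z \<in> \<delta>} \<in> sets borel"
proof -
  assume "\<delta> \<in> sets borel"
  then have "F -` \<delta> \<inter> space (restrict_space borel S) \<in> sets (restrict_space borel S)"
    by (rule measurable_sets[OF F])
  moreover have "F -` \<delta> \<inter> space (restrict_space borel S) = {z \<in> S. F z \<in> \<delta>}"
    by (auto simp: space_restrict_space)
  ultimately show ?thesis using S by (auto simp: sets_restrict_space)
qed

lemma spectral_measure_EF: "spectral_measure EF"
  unfolding spectral_measure_def image_measure_def
proof (intro conjI ballI allI impI)
  fix \<delta> :: "complex set" assume d: "\<delta> \<in> sets borel"
  show "complex_linear (E {z \<in> S. F z \<in> \<delta>})"
    using d by (intro complex_linear_E sets_preimage)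
  show "E {z \<in> S. F z \<in> \<delta>} o\<^sub>L E {z \<in> S. F z \<in> \<delta>} = E {z \<in> S. F z \<in> \<delta>}"
    using sets_preimage[OF d] by (simp flip: E_Int)
  fix \<epsilon> :: "complex set" assume e: "\<epsilon> \<in> sets borel"
  have "{z \<in> S. F z \<in> \<delta> \<inter> \<epsilon>} = {z \<in> S. F z \<in> \<delta>} \<inter> {z \<in> S. F z \<in> \<epsilon>}" by auto
  then show "E {z \<in> S. F z \<in> \<delta> \<inter> \<epsilon>} = E {z \<in> S. F z \<in> \<delta>} o\<^sub>L E {z \<in> S. F z \<in> \<epsilon>}"
    using d e by (simp only: E_Int sets_preimage)
next
  fix D :: "nat \<Rightarrow> complex set" and f
  assume D: "range D \<subseteq> sets borel" "disjoint_family D"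
  have "range (\<lambda>n. {z \<in> S. F z \<in> D n}) \<subseteq> sets borel"
    using D(1) by (auto intro!: sets_preimage)
  moreover have "disjoint_family (\<lambda>n. {z \<in> S. F z \<in> D n})"
    using D(2) by (fastforce simp: disjoint_family_on_def)
  moreover have "{z \<in> S. F z \<in> (\<Union>n. D n)} = (\<Union>n. {z \<in> S. F z \<in> D n})" by auto
  ultimately show "(\<lambda>n. E {z \<in> S. F z \<in> D n} f) sums E {z \<in> S. F z \<in> (\<Union>n. D n)} f"
    using E_sums by presburger
qed (simp_all add: E_S)

sublocale EF: spectral_meas EF
  by unfold_locales (rule spectral_measure_EF)

lemma simple_integral_image:
  assumes "simple_function borel s"
  shows "simple_spectral_integral EF UNIV s = simple_spectral_integral E S (\<lambda>z. s (F z))"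
proof -
  have "simple_spectral_integral EF UNIV s = (\<Sum>c\<in>range s. c *\<^sub>C E {z \<in> S. s (F z) = c})"
    by (simp add: simple_spectral_integral_def image_measure_def)
  \<comment> \<open>Values of s that are not attained on F(S) have empty preimage and contribute
    nothing.\<close>
  also have "\<dots> = (\<Sum>c\<in>(\<lambda>z. s (F z)) ` S. c *\<^sub>C E {z \<in> S. s (F z) = c})"
  proof (rule sum.mono_neutral_right)
    show "finite (range s)" using simple_functionD(1)[OF assms] by simp
    show "\<forall>c\<in>range s - (\<lambda>z. s (F z)) ` S. c *\<^sub>C E {z \<in> S. s (F z) = c} = 0"
    proof
      fix c assume "c \<in> range s - (\<lambda>z. s (F z)) ` S"
      then have "{z \<in> S. s (F z) = c} = {}" by blast
      then show "c *\<^sub>C E {z \<in> S. s (F z) = c} = 0" by (simp only: E_empty scaleC.zero_right)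
    qed
  qed auto
  finally show ?thesis by (simp add: simple_spectral_integral_def)
qed

lemma bounded_spectral_integral_image:
  assumes "bounded_borel g"
  shows "bounded_spectral_integral E S (\<lambda>z. g (F z)) = EF.\<Phi> g"
proof (rule bounded_spectral_integral_eqI[OF S])
  obtain s where s: "\<And>n. simple_function (restrict_space borel UNIV) (s n)"
    "uniform_limit UNIV s g sequentially" "(\<lambda>n. simple_spectral_integral EF UNIV (s n)) \<longlonglongrightarrow> EF.\<Phi> g"
    by (rule spectral_limitE[OF EF.\<Phi>_limit[OF assms]]) (rule that)
  have s1: "simple_function borel (s n)" for n
    using s(1)[of n] by (simp add: simple_function_def space_restrict_space sets_restrict_space)
  have "simple_function (restrict_space borel S) (\<lambda>z. s n (F z))" for n
  proof (rule simple_function_borel_measurable)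
    show "(\<lambda>z. s n (F z)) \<in> borel_measurable (restrict_space borel S)"
      using borel_measurable_simple_function[OF s1] F by (rule measurable_compose[rotated])
    show "finite ((\<lambda>z. s n (F z)) ` space (restrict_space borel S))"
      using simple_functionD(1)[OF s1[of n]] by (rule finite_subset[rotated]) auto
  qed
  moreover have "uniform_limit S (\<lambda>n z. s n (F z)) (\<lambda>z. g (F z)) sequentially"
    using s(2) by (rule uniform_limit_compose') auto
  ultimately show "spectral_limit E S (\<lambda>z. g (F z)) (EF.\<Phi> g)"
    using s(3) unfolding spectral_limit_def simple_integral_image[OF s1]
    by (intro exI[of _ "\<lambda>n z. s n (F z)"]) simp
qed

text \<open>Cutting F at modulus n is composing the identity cut at modulus n with F. The two
  defining sequences therefore agree term by term, which gives equality of the domains along with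
  the values.\<close>

lemma spectral_integral_image: "spectral_integral E S F = EF.integral_id"
proof -
  have "bounded_spectral_integral E S (truncation S F n) = EF.\<Phi> (EF.trunc n)" for n
  proof -
    have eq: "truncation S F n z = EF.trunc n (F z)" if "z \<in> S" for z
      using that by (simp add: truncation_def EF.trunc_altdef indicator_def)
    have "bounded_spectral_integral E S (truncation S F n)
        = bounded_spectral_integral E S (\<lambda>z. EF.trunc n (F z))"
      unfolding bounded_spectral_integral_altdef by (subst spectral_limit_cong[OF eq]) auto
    then show ?thesis by (simp add: bounded_spectral_integral_image EF.bounded_borel_trunc)
  qed
  then show ?thesis
    by (simp add: fun_eq_iff spectral_integral_def EF.integral_id_def EF.\<Phi>_def EF.trunc_def)
qed

lemma EF_singleton:
  assumes "inj_on F S" "\<mu> \<in> S"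
  shows "EF {F \<mu>} = E {\<mu>}"
proof -
  have "{z \<in> S. F z \<in> {F \<mu>}} = {\<mu>}" using assms by (auto dest: inj_onD)
  then show ?thesis by (simp add: image_measure_def)
qed

lemma EF_disjoint: "\<delta> \<inter> F ` S = {} \<Longrightarrow> EF \<delta> = 0"
proof -
  assume "\<delta> \<inter> F ` S = {}"
  then have "{z \<in> S. F z \<in> \<delta>} = {}" by auto
  then show ?thesis by (simp only: image_measure_def E_empty)
qed

text \<open>Carries non-nullness forward along F. With singletons it moves eigenvalues, for F not
  necessarily injective; with discs it is combined with continuity. Intersecting \<delta> with S
  loses nothing because E(S) = I.\<close>

lemma E_subset_preimage:
  assumes "E \<delta> \<noteq> 0" "\<delta> \<in> sets borel" "\<epsilon> \<in> sets borel" "\<And>z. z \<in> \<delta> \<inter> S \<Longrightarrow> F z \<in> \<epsilon>"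
  shows "EF \<epsilon> \<noteq> 0"
proof
  assume "EF \<epsilon> = 0"
  then have "E (\<delta> \<inter> S) = 0"
    using assms S sets_preimage[OF assms(3)] unfolding image_measure_def
    by (elim E_null_mono) auto
  then show False
    using assms(1,2) S E_Int[of \<delta> UNIV] by (simp add: E_Int E_S)
qed

end

section \<open>Spectral mapping for the point and continuous spectra\<close>

theorem theorem4p1:
  fixes A :: "'a::complex_banach \<rightharpoonup> 'a"
    and E :: "complex set \<Rightarrow> ('a \<Rightarrow>\<^sub>L 'a)"
  assumes "scalar_type_spectral_operator A"
    and "resolution_of_identity A E"
  shows
    "(\<forall>F. F \<in> borel_measurable (restrict_space borel (spectrum A)) \<longrightarrow>
        point_spectrum (borel_calculus A E F) \<supseteq> F ` point_spectrum A)
     \<and>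
     (\<forall>F. F \<in> borel_measurable (restrict_space borel (spectrum A)) \<and> inj_on F (spectrum A) \<longrightarrow>
        point_spectrum (borel_calculus A E F) = F ` point_spectrum A
        \<and> scalar_type_spectral_operator (borel_calculus A E F)
        \<and> (\<forall>\<mu>\<in>point_spectrum A.
             (\<forall>E\<^sub>F. resolution_of_identity (borel_calculus A E F) E\<^sub>F \<longrightarrow> E\<^sub>F {F \<mu>} = E {\<mu>})
             \<and> kernel (shift (borel_calculus A E F) (F \<mu>)) = kernel (shift A \<mu>))
        \<and> resolvent_set (borel_calculus A E F) \<union> continuous_spectrum (borel_calculus A E F)
            \<supseteq> F ` continuous_spectrum A
        \<and> (point_spectrum A = {} \<longrightarrow> point_spectrum (borel_calculus A E F) = {}))
     \<and>
     (\<forall>F. continuous_on (spectrum A) F \<and> inj_on F (spectrum A) \<longrightarrow>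
        continuous_spectrum (borel_calculus A E F) =
          F ` continuous_spectrum A \<union> (closure (F ` spectrum A) - F ` spectrum A)
        \<and> (closed (F ` spectrum A) \<longrightarrow>
             continuous_spectrum (borel_calculus A E F) = F ` continuous_spectrum A)
        \<and> (bounded_operator A \<longrightarrow>
             closed (F ` spectrum A) \<and> bounded_operator (borel_calculus A E F)))"
proof -
  interpret E: spectral_meas E
    using assms(2) by unfold_locales (simp add: resolution_of_identity_def)
  have A: "E.integral_id = A"
    using assms(2) by (simp add: resolution_of_identity_def E.integral_id_def)
  let ?S = "spectrum A"
  have spec: "closed ?S" "?S \<in> sets borel" "E ?S = id_blinfun"
    using E.closed_spectrum_integral_id E.E_spectrum by (auto simp: A)
  have p: "point_spectrum A = {\<mu>. E {\<mu>} \<noteq> 0}"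
    and c: "continuous_spectrum A = {\<mu>. E {\<mu>} = 0 \<and> \<mu> \<in> ?S}"
    and s: "?S = {\<mu>. \<forall>r>0. E (ball \<mu> r) \<noteq> 0}"
    using E.point_spectrum_integral_id E.continuous_spectrum_integral_id E.spectrum_integral_id by (auto simp: A)
  \<comment> \<open>A non-null point makes every disc about it non-null. Thus eigenvalues lie in the
    set on which F is measurable and, later, injective.\<close>
  have pS: "\<mu> \<in> ?S" if "E {\<mu>} \<noteq> 0" for \<mu>
    using that E.E_null_mono[of "ball \<mu> _" "{\<mu>}"] by (auto simp: s)
  have map: "spectral_map E ?S F" if "F \<in> borel_measurable (restrict_space borel ?S)" for F
    using that spec by unfold_locales
  show ?thesis
  proof (intro conjI allI impI; (elim conjE)?)
    fix F :: "complex \<Rightarrow> complex" assume "F \<in> borel_measurable (restrict_space borel ?S)"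
    then interpret spectral_map E ?S F by (rule map)
    have FA: "borel_calculus A E F = EF.integral_id"
      by (simp add: borel_calculus_def spectral_integral_image)
    show "F ` point_spectrum A \<subseteq> point_spectrum (borel_calculus A E F)"
      unfolding FA EF.point_spectrum_integral_id p using E_subset_preimage[of "{_}" "{F _}"] by auto
  next
    fix F :: "complex \<Rightarrow> complex" assume "F \<in> borel_measurable (restrict_space borel ?S)" and inj: "inj_on F ?S"
    then interpret spectral_map E ?S F by (intro map)
    have FA: "borel_calculus A E F = EF.integral_id"
      by (simp add: borel_calculus_def spectral_integral_image)
    have sing: "EF {F \<mu>} = E {\<mu>}" if "\<mu> \<in> ?S" for \<mu>
      using inj that by (rule EF_singleton)
    have out: "\<nu> \<in> F ` ?S" if "EF {\<nu>} \<noteq> 0" for \<nu>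
      using EF_disjoint[of "{\<nu>}"] that by auto
    show ps: "point_spectrum (borel_calculus A E F) = F ` point_spectrum A"
      unfolding FA EF.point_spectrum_integral_id p using out sing pS by (auto simp: image_iff) metis
    then show "point_spectrum (borel_calculus A E F) = {}" if "point_spectrum A = {}"
      using that by simp
    show "scalar_type_spectral_operator (borel_calculus A E F)"
      unfolding FA by (rule EF.scalar_type_integral_id)
    \<comment> \<open>Injectivity makes the point F(\<mu>) null for the image measure. Whether some
      disc about F(\<mu>) is null decides between the two sets on the right, and both cases are
      allowed.\<close>
    show "F ` continuous_spectrum A
        \<subseteq> resolvent_set (borel_calculus A E F) \<union> continuous_spectrum (borel_calculus A E F)"
      unfolding FA EF.resolvent_set_integral_id EF.continuous_spectrum_integral_id c using sing by auto
    show "\<forall>\<mu>\<in>point_spectrum A.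
        (\<forall>E\<^sub>F. resolution_of_identity (borel_calculus A E F) E\<^sub>F \<longrightarrow> E\<^sub>F {F \<mu>} = E {\<mu>})
        \<and> kernel (shift (borel_calculus A E F) (F \<mu>)) = kernel (shift A \<mu>)"
    proof (intro ballI conjI allI impI)
      fix \<mu> assume "\<mu> \<in> point_spectrum A"
      then have \<mu>: "EF {F \<mu>} = E {\<mu>}" using p pS sing by auto
      show "kernel (shift (borel_calculus A E F) (F \<mu>)) = kernel (shift A \<mu>)"
        using EF.kernel_shift_integral_id E.kernel_shift_integral_id by (simp add: FA A \<mu>)
      show "E\<^sub>F {F \<mu>} = E {\<mu>}" if "resolution_of_identity (borel_calculus A E F) E\<^sub>F" for E\<^sub>F
        using resolution_of_identity_singleton_unique[OF that[unfolded FA] EF.resolution_of_identity_integral_id]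
        by (simp add: \<mu>)
    qed
  next
    fix F :: "complex \<Rightarrow> complex" assume cont: "continuous_on ?S F" and inj: "inj_on F ?S"
    have "F \<in> borel_measurable (restrict_space borel ?S)"
      using cont by (rule borel_measurable_continuous_on_restrict)
    then interpret spectral_map E ?S F by (rule map)
    have FA: "borel_calculus A E F = EF.integral_id"
      by (simp add: borel_calculus_def spectral_integral_image)
    \<comment> \<open>The spectrum of F(A) is the closure of F(\<sigma>(A)): discs missing the image
      are null for any F, while the converse needs continuity, which maps a small non-null disc
      about \<mu> into the given disc.\<close>
    have closure: "(\<forall>r>0. EF (ball \<nu> r) \<noteq> 0) \<longleftrightarrow> \<nu> \<in> closure (F ` ?S)" for \<nu>
    proof
      assume "\<forall>r>0. EF (ball \<nu> r) \<noteq> 0"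
      then have "\<exists>y\<in>F ` ?S. dist y \<nu> < r" if "r > 0" for r
        using EF_disjoint[of "ball \<nu> r"] that by (force simp: dist_commute)
      then show "\<nu> \<in> closure (F ` ?S)" by (simp add: closure_approachable)
    next
      assume \<nu>: "\<nu> \<in> closure (F ` ?S)"
      show "\<forall>r>0. EF (ball \<nu> r) \<noteq> 0"
      proof (intro allI impI)
        fix r :: real assume "r > 0"
        then obtain \<mu> where \<mu>: "\<mu> \<in> ?S" "dist (F \<mu>) \<nu> < r"
          using \<nu> by (auto simp: closure_approachable)
        \<comment> \<open>The tolerance \<open>r - dist (F \<mu>) \<nu>\<close> is the room left in
          the disc about \<nu>, so the triangle inequality keeps F z inside.\<close>
        then obtain d where d: "d > 0"
            "\<And>z. z \<in> ?S \<Longrightarrow> dist z \<mu> < d \<Longrightarrow> dist (F z) (F \<mu>) < r - dist (F \<mu>) \<nu>"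
          using cont unfolding continuous_on_iff by (metis diff_gt_0_iff_gt)
        show "EF (ball \<nu> r) \<noteq> 0"
        proof (rule E_subset_preimage)
          show "E (ball \<mu> d) \<noteq> 0" using \<mu>(1) d(1) s by blast
          fix z assume "z \<in> ball \<mu> d \<inter> ?S"
          then show "F z \<in> ball \<nu> r"
            using d(2)[of z] dist_triangle[of "F z" \<nu> "F \<mu>"] by (auto simp: dist_commute)
        qed auto
      qed
    qed
    have sing: "EF {F \<mu>} = E {\<mu>}" if "\<mu> \<in> ?S" for \<mu>
      using inj that by (rule EF_singleton)
    have out: "EF {\<nu>} = 0" if "\<nu> \<notin> F ` ?S" for \<nu>
      using EF_disjoint[of "{\<nu>}"] that by auto
    \<comment> \<open>In the closure but outside the image, a point has empty preimage and so is
      null, which puts it in the continuous spectrum. Inside the image, nullity of F(\<mu>) is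
      nullity of \<mu>.\<close>
    show cs: "continuous_spectrum (borel_calculus A E F)
        = F ` continuous_spectrum A \<union> (closure (F ` ?S) - F ` ?S)"
      unfolding FA EF.continuous_spectrum_integral_id closure c
      using sing out closure_subset[of "F ` ?S"] by (auto simp: image_iff)
    show "continuous_spectrum (borel_calculus A E F) = F ` continuous_spectrum A"
      if "closed (F ` ?S)"
      using that cs by (simp add: closure_closed)
    assume "bounded_operator A"
    then have "bounded ?S"
      using E.bounded_spectrum_integral_id by (simp add: A)
    with spec(1) have "compact ?S" by (simp only: compact_eq_bounded_closed)
    then have comp: "compact (F ` ?S)"
      using cont by (rule compact_continuous_image[rotated])
    then show "closed (F ` ?S)" by (rule compact_imp_closed)
    obtain b where b: "F ` ?S \<subseteq> cball 0 b"
      using compact_imp_bounded[OF comp] by (auto simp: bounded_iff subset_iff)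
    then have "{z \<in> ?S. F z \<in> cball 0 b} = ?S" by auto
    then have "EF (cball 0 b) = id_blinfun"
      by (simp only: image_measure_def spec)
    then show "bounded_operator (borel_calculus A E F)"
      unfolding FA by (rule EF.bounded_operator_integral_id)
  qed
qed

end
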